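(* Let $n\ge 2$ and let $Q\subset\mathbb{R}^2$ be any convex $(n+3)$-gon. Then the polytope $\mathrm{Ass}_n^{\rm I}(Q)=\Sigma(Q)$ (the secondary polytope of $Q$) has no parallel facets; that is, no two distinct facets of $\mathrm{Ass}_n^{\rm I}(Q)$ are parallel.
   Context: Let $Q\subset\mathbb{R}^2$ be a convex $(n+3)$-gon with vertices labeled $1,\dots,n+3$. Triangulations of $Q$ are understood to be without new vertices. The GKZ vector of a triangulation $t$ of $Q$ is $$v(t)=\sum_{i=1}^{n+3}\ \sum_{\sigma\in t\,:\, i\in\sigma}\mathrm{vol}(\sigma)\,e_i\in\mathbb{R}^{n+3},$$ where $\sigma$ ranges over the triangles of $t$ having $i$ as a vertex, $\mathrm{vol}$ is the area, and $e_1,\dots,e_{n+3}$ is the standard basis. The secondary polytope of $Q$ is $\Sigma(Q)=\mathrm{conv}\{v(t): t\text{ a triangulation of }Q\}\subset\mathbb{R}^{n+3}$, and $\mathrm{Ass}_n^{\rm I}(Q):=\Sigma(Q)$. It is an $n$-dimensional polytope. For a facet $F$ of a polytope, let $V_F=\mathrm{span}\{u-v: u,v\text{ vertices of }F\}$. Two facets $F,F'$ are parallel if $V_F=V_{F'}$. *)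

theory Defs
  imports "HOL-Analysis.Analysis"
begin

text \<open>
  The index type \<^typ>\<open>'v\<close> plays the role of the label set \<open>{1, ..., n+3}\<close>, so that
  \<^typ>\<open>real ^ 'v\<close> is the ambient space of the GKZ vectors. The labelling \<open>p\<close> may enumerate the
  vertices of \<open>Q\<close> in any order; none of the notions below depends on the cyclic order.
\<close>

definition labelled_convex_polygon :: "(real ^ 2) set \<Rightarrow> ('v::finite \<Rightarrow> real ^ 2) \<Rightarrow> bool" where
  "labelled_convex_polygon Q p \<longleftrightarrow>
     polytope Q \<and> aff_dim Q = 2 \<and> bij_betw p UNIV {x. x extreme_point_of Q}"

text \<open>
  A triangulation is given by its set of (closed) triangles. The library predicate
  \<^const>\<open>triangulation\<close> only says that they are simplices meeting along common faces.
\<close>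

definition polygon_triangulation :: "(real ^ 2) set \<Rightarrow> (real ^ 2) set set \<Rightarrow> bool" where
  "polygon_triangulation Q t \<longleftrightarrow>
     triangulation t \<and>
     (\<forall>\<sigma>\<in>t. 2 simplex \<sigma>) \<and>
     \<Union>t = Q \<and>
     (\<forall>\<sigma>\<in>t. \<forall>x. x extreme_point_of \<sigma> \<longrightarrow> x extreme_point_of Q)"

definition gkz_vector :: "('v::finite \<Rightarrow> real ^ 2) \<Rightarrow> (real ^ 2) set set \<Rightarrow> real ^ 'v" where
  "gkz_vector p t =
     (\<Sum>i\<in>UNIV. \<Sum>\<sigma>\<in>{\<sigma>\<in>t. p i extreme_point_of \<sigma>}. measure lebesgue \<sigma> *\<^sub>R axis i 1)"

definition secondary_polytope ::
    "(real ^ 2) set \<Rightarrow> ('v::finite \<Rightarrow> real ^ 2) \<Rightarrow> (real ^ 'v) set" where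
  "secondary_polytope Q p = convex hull {gkz_vector p t | t. polygon_triangulation Q t}"

definition Ass_I :: "(real ^ 2) set \<Rightarrow> ('v::finite \<Rightarrow> real ^ 2) \<Rightarrow> (real ^ 'v) set" where
  "Ass_I Q p = secondary_polytope Q p"

definition direction_space :: "'a::euclidean_space set \<Rightarrow> 'a set" where
  "direction_space F = span {u - v | u v. u extreme_point_of F \<and> v extreme_point_of F}"

definition parallel_facets :: "'a::euclidean_space set \<Rightarrow> 'a set \<Rightarrow> bool" where
  "parallel_facets F F' \<longleftrightarrow> direction_space F = direction_space F'"

end

theory Submission
  imports Defs
begin

text \<open>
  A vector \<open>w\<close> of heights on the vertices of \<open>Q\<close> is also a linear functional on the secondary
  polytope. Its value at the GKZ vector of a triangulation \<open>t\<close> is three times the integral over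
  \<open>Q\<close> of the function that interpolates \<open>w\<close> linearly on each triangle of \<open>t\<close>. Among all these
  interpolants the smallest is the lower convex envelope \<open>f\<close> of the heights, and some
  triangulation realises it (\<open>lower_envelope\<close>). Hence the functional is minimal exactly at the
  triangulations on whose triangles \<open>f\<close> is affine (\<open>gkz_convex_function\<close>), and it is
  constant only if the heights come from an affine function (\<open>constant_heights_affine\<close>).

  A facet is the set of minimisers of some \<open>w\<close> whose envelope \<open>f\<close> is not affine. Take a maximal
  region on which \<open>f\<close> is affine and an edge of it that meets the interior of \<open>Q\<close>. This edge is
  a diagonal of \<open>Q\<close>, and \<open>f\<close> bends along all of it, so no triangulation adapted to \<open>f\<close> crosses
  it. The function that vanishes on one side of the diagonal and is linear on the other side is
  therefore affine on the triangles of every triangulation in the facet. The face of the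
  secondary polytope that it minimises is proper and contains the facet, so it equals the facet
  (\<open>facet_is_fold_face\<close>): every facet is cut out by a function folded along one diagonal.

  Two parallel facets give two folded functions that are both constant on the first facet.
  The functionals that are constant on a facet form a space of one dimension more than those
  that are constant on the whole polytope, so a nontrivial combination of the two is constant on
  the polytope, hence affine on the vertices of \<open>Q\<close>. When \<open>Q\<close> has at least five vertices,
  evaluation at suitable vertices shows that this is impossible for different diagonals
  (\<open>folds_independent\<close>). If the diagonals agree, so do the facets.
\<close>

section \<open>Affine functions and orientation in the plane\<close>

definition affine_fun :: "(real^2 \<Rightarrow> real) \<Rightarrow> bool" where
  "affine_fun f \<longleftrightarrow> (\<exists>n d. \<forall>x. f x = n \<bullet> x + d)"

lemma affine_funE:
  assumes "affine_fun f"
  obtains n d where "\<And>x. f x = n \<bullet> x + d"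
  using assms unfolding affine_fun_def by blast

lemma affine_funI: "(\<And>x. f x = n \<bullet> x + d) \<Longrightarrow> affine_fun f"
  unfolding affine_fun_def by blast

lemma affine_fun_const: "affine_fun (\<lambda>x. c)"
  by (rule affine_funI[of _ 0 c]) simp

lemma affine_fun_cmult:
  assumes "affine_fun f" shows "affine_fun (\<lambda>x. c * f x)"
proof -
  obtain n d where "\<And>x. f x = n \<bullet> x + d" using assms by (rule affine_funE) blast
  then show ?thesis by (intro affine_funI[of _ "c *\<^sub>R n" "c * d"]) (simp add: algebra_simps)
qed

lemma affine_fun_add:
  assumes "affine_fun f" "affine_fun g" shows "affine_fun (\<lambda>x. f x + g x)"
proof -
  obtain n d where "\<And>x. f x = n \<bullet> x + d" using assms(1) by (rule affine_funE) blast
  moreover obtain m e where "\<And>x. g x = m \<bullet> x + e" using assms(2) by (rule affine_funE) blast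
  ultimately show ?thesis by (intro affine_funI[of _ "n + m" "d + e"]) (simp add: algebra_simps)
qed

lemma affine_fun_diff:
  assumes "affine_fun f" "affine_fun g" shows "affine_fun (\<lambda>x. f x - g x)"
  using affine_fun_add[OF assms(1) affine_fun_cmult[OF assms(2), of "-1"]] by simp

lemma affine_fun_convex_on:
  assumes "affine_fun f" shows "convex_on UNIV f"
proof -
  obtain n d where f: "\<And>x. f x = n \<bullet> x + d" using assms by (rule affine_funE) blast
  show ?thesis
  proof (rule convex_onI)
    fix t :: real and x y assume "0 < t" "t < 1"
    show "f ((1 - t) *\<^sub>R x + t *\<^sub>R y) \<le> (1 - t) * f x + t * f y"
      unfolding f by (simp add: inner_add_right algebra_simps)
  qed simp
qed

lemma affine_fun_combination:
  assumes "affine_fun f" "u + v + w = 1"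
  shows "f (u *\<^sub>R a + v *\<^sub>R b + w *\<^sub>R c) = u * f a + v * f b + w * f c"
proof -
  obtain n d where f: "\<And>x. f x = n \<bullet> x + d" using assms(1) by (rule affine_funE) blast
  have "d = (u + v + w) * d" using assms(2) by simp
  then show ?thesis unfolding f by (simp add: inner_add_right algebra_simps)
qed

lemma affine_fun_segment:
  assumes "affine_fun f"
  shows "f ((1 - t) *\<^sub>R a + t *\<^sub>R b) = (1 - t) * f a + t * f b"
  using affine_fun_combination[OF assms, of "1-t" t 0 a b] by simp

lemma affine_fun_continuous_on:
  assumes "affine_fun f" shows "continuous_on S f"
proof -
  obtain n d where f: "f = (\<lambda>x. n \<bullet> x + d)" using assms unfolding affine_fun_def by blast
  show ?thesis unfolding f by (intro continuous_intros)
qed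

lemma affine_fun_nonneg_hull:
  assumes "affine_fun f" "\<And>s. s \<in> S \<Longrightarrow> 0 \<le> f s" "x \<in> convex hull S"
  shows "0 \<le> f x"
proof -
  obtain n d where f: "\<And>x. f x = n \<bullet> x + d" using assms(1) by (rule affine_funE) blast
  have "convex hull S \<subseteq> {x. n \<bullet> x \<ge> - d}"
    by (rule hull_minimal) (use assms(2) f convex_halfspace_ge in force)+
  then show ?thesis using assms(3) f by force
qed

text \<open>
  Where a nonnegative affine function vanishes on a convex hull is a face of it, and a face is
  spanned by the generators that it contains.
\<close>

lemma affine_fun_zero_hull:
  assumes f: "affine_fun f" and pos: "\<And>s. s \<in> S \<Longrightarrow> 0 \<le> f s"
    and S: "finite S" and x: "x \<in> convex hull S" and fx: "f x = 0"
  shows "x \<in> convex hull {s \<in> S. f s = 0}"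
proof -
  obtain n d where nd: "\<And>x. f x = n \<bullet> x + d" using f by (rule affine_funE) blast
  have "convex hull S \<inter> {y. (- n) \<bullet> y = d} face_of convex hull S"
  proof (rule face_of_Int_supporting_hyperplane_le)
    fix y assume "y \<in> convex hull S"
    then show "- n \<bullet> y \<le> d" using affine_fun_nonneg_hull[OF f pos, of S y] nd by simp
  qed (rule convex_convex_hull)
  then obtain S' where S': "S' \<subseteq> S" "convex hull S \<inter> {y. (- n) \<bullet> y = d} = convex hull S'"
    using face_of_convex_hull_subset[OF finite_imp_compact[OF S]] by blast
  have "S' \<subseteq> {s \<in> S. f s = 0}"
    using S' hull_subset[of S' convex] nd by fastforce
  moreover have "x \<in> convex hull S \<inter> {y. (- n) \<bullet> y = d}"
    using x fx nd[of x] by (simp add: eq_neg_iff_add_eq_0 add.commute)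
  then have "x \<in> convex hull S'" unfolding S'(2) .
  ultimately show ?thesis using hull_mono by blast
qed

text \<open>
  A nonzero gradient would make the function negative just beyond an interior zero.
\<close>

lemma affine_fun_zero_interior:
  assumes f: "affine_fun f" and pos: "\<And>x. x \<in> C \<Longrightarrow> 0 \<le> f x"
    and z: "z \<in> interior C" "f z = 0"
  shows "f x = 0"
proof -
  obtain n d where nd: "\<And>x. f x = n \<bullet> x + d" using f by (rule affine_funE) blast
  obtain e where e: "e > 0" "cball z e \<subseteq> C" using z(1) mem_interior_cball by blast
  have "n = 0"
  proof (rule ccontr)
    assume n: "n \<noteq> 0"
    define y where "y = z - (e / norm n) *\<^sub>R n"
    have "y \<in> cball z e" using e(1) n by (simp add: y_def dist_norm)
    then have "0 \<le> f y" using e(2) pos by blast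
    moreover have "f y = f z - (e / norm n) * (n \<bullet> n)"
      unfolding nd y_def by (simp add: inner_diff_right)
    moreover have "(e / norm n) * (n \<bullet> n) > 0" using e(1) n by simp
    ultimately show False using z(2) by linarith
  qed
  then show ?thesis using nd z(2) by simp
qed

text \<open>
  Twice the signed area of the triangle \<open>a b c\<close>. For fixed \<open>a \<noteq> b\<close> it is an affine function
  of \<open>c\<close> whose zero set is the line through \<open>a\<close> and \<open>b\<close>, so its sign says on which side of
  this line \<open>c\<close> lies.
\<close>

definition orient :: "real^2 \<Rightarrow> real^2 \<Rightarrow> real^2 \<Rightarrow> real" where
  "orient a b c = (b$1 - a$1) * (c$2 - a$2) - (b$2 - a$2) * (c$1 - a$1)"

lemma orient_swap: "orient b a c = - orient a b c"
  by (simp add: orient_def algebra_simps)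

lemma orient_rotate: "orient b c a = orient a b c"
  by (simp add: orient_def algebra_simps)

lemma orient_same [simp]: "orient a a c = 0" "orient a b a = 0" "orient a b b = 0"
  by (simp_all add: orient_def algebra_simps)

lemma affine_fun_orient: "affine_fun (orient a b)"
  by (rule affine_funI[of _ "vector [a$2 - b$2, b$1 - a$1]"
        "a$1 * (b$2 - a$2) - a$2 * (b$1 - a$1)"])
     (simp add: orient_def inner_vec_def sum_2 algebra_simps)

lemma orient_eq_0_iff_collinear: "orient a b c = 0 \<longleftrightarrow> collinear {a, b, c}"
proof -
  define u v where "u = b - a" and "v = c - a"
  have o: "orient a b c = u$1 * v$2 - u$2 * v$1" by (simp add: orient_def u_def v_def)
  have "collinear {a, b, c} \<longleftrightarrow> collinear {0, u, v}"
    using collinear_3[of b a c] by (simp add: insert_commute u_def v_def)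
  also have "\<dots> \<longleftrightarrow> \<bar>u \<bullet> v\<bar> = norm u * norm v"
    by (rule norm_cauchy_schwarz_equal[symmetric])
  also have "\<dots> \<longleftrightarrow> \<bar>u \<bullet> v\<bar>\<^sup>2 = (norm u * norm v)\<^sup>2"
    by (rule power2_eq_iff_nonneg[symmetric]) simp_all
  also have "\<dots> \<longleftrightarrow> (u \<bullet> v)\<^sup>2 = (u \<bullet> u) * (v \<bullet> v)"
    by (simp add: power_mult_distrib dot_square_norm)
  \<comment> \<open>Lagrange's identity turns equality in the Cauchy-Schwarz inequality into a vanishing area.\<close>
  also have "(u \<bullet> u) * (v \<bullet> v) = (u \<bullet> v)\<^sup>2 + (u$1 * v$2 - u$2 * v$1)\<^sup>2"
    by (simp add: inner_vec_def sum_2 power2_eq_square algebra_simps)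
  finally show ?thesis unfolding o by simp
qed

text \<open>
  The barycentric coordinates of \<open>x\<close> are quotients of signed areas; clearing the denominator
  makes the formula valid for degenerate triangles as well.
\<close>

lemma affine_fun_orient_expansion:
  assumes "affine_fun f"
  shows "orient a b c * f x = orient x b c * f a + orient a x c * f b + orient a b x * f c"
proof -
  obtain n d where "\<And>x. f x = n \<bullet> x + d" using assms by (rule affine_funE) blast
  then show ?thesis by (simp add: orient_def inner_vec_def sum_2 algebra_simps)
qed

lemma affine_fun_eq_0:
  assumes "affine_fun f" "orient a b c \<noteq> 0" "f a = 0" "f b = 0" "f c = 0"
  shows "f x = 0"
  using affine_fun_orient_expansion[OF assms(1), of a b c x] assms by simp

text \<open>
  The affine function with values \<open>\<alpha>\<close>, \<open>\<beta>\<close>, \<open>\<gamma>\<close> at \<open>a\<close>, \<open>b\<close>, \<open>c\<close>, written in barycentric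
  coordinates. The explicit formula shows that it depends linearly, hence continuously, on the
  three values, which the perturbation argument for triangulations relies on.
\<close>

definition interp :: "real^2 \<Rightarrow> real^2 \<Rightarrow> real^2 \<Rightarrow> real \<Rightarrow> real \<Rightarrow> real \<Rightarrow> real^2 \<Rightarrow> real" where
  "interp a b c \<alpha> \<beta> \<gamma> x = (orient b c x * \<alpha> + orient c a x * \<beta> + orient a b x * \<gamma>) / orient a b c"

lemma affine_fun_interp: "affine_fun (interp a b c \<alpha> \<beta> \<gamma>)"
proof -
  have eq: "interp a b c \<alpha> \<beta> \<gamma> = (\<lambda>x. (\<alpha> / orient a b c) * orient b c x
     + (\<beta> / orient a b c) * orient c a x + (\<gamma> / orient a b c) * orient a b x)"
    by (simp add: interp_def fun_eq_iff add_divide_distrib mult.commute)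
  show ?thesis unfolding eq by (intro affine_fun_add affine_fun_cmult affine_fun_orient)
qed

lemma interp_vertices:
  assumes "orient a b c \<noteq> 0"
  shows "interp a b c \<alpha> \<beta> \<gamma> a = \<alpha>" "interp a b c \<alpha> \<beta> \<gamma> b = \<beta>" "interp a b c \<alpha> \<beta> \<gamma> c = \<gamma>"
  using assms orient_rotate[of b c a] orient_rotate[of c a b] by (simp_all add: interp_def)

lemma interp_unique:
  assumes "affine_fun f" "orient a b c \<noteq> 0"
  shows "f x = interp a b c (f a) (f b) (f c) x"
  using affine_fun_orient_expansion[OF assms(1), of a b c x] assms(2)
    orient_rotate[of b c x] orient_rotate[of c x a] orient_rotate[of a x c] orient_rotate[of c a x]
  by (simp add: interp_def field_simps)

lemma triangle_affine_independent:
  assumes "orient a b c \<noteq> 0"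
  shows "\<not> affine_dependent {a, b, c}" "card {a, b, c} = 3"
proof -
  have "a \<noteq> b" "a \<noteq> c" "b \<noteq> c" using assms by auto
  then show "card {a, b, c} = 3" by simp
  show "\<not> affine_dependent {a, b, c}"
    using assms collinear_3_eq_affine_dependent[of a b c] by (simp add: orient_eq_0_iff_collinear)
qed

lemma triangle_simplex:
  assumes "orient a b c \<noteq> 0"
  shows "2 simplex (convex hull {a, b, c})"
  unfolding simplex_def using triangle_affine_independent[OF assms] by (intro exI[of _ "{a,b,c}"]) simp

lemma triangle_interior:
  assumes "orient a b c \<noteq> 0"
  shows "interior (convex hull {a, b, c}) \<noteq> {}"
proof -
  have "aff_dim (convex hull {a, b, c}) = 2"
    using triangle_simplex[OF assms] aff_dim_simplex by blast
  then show ?thesis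
    using rel_interior_interior[of "convex hull {a,b,c}"] rel_interior_eq_empty[of "convex hull {a,b,c}"]
      aff_dim_eq_full[of "convex hull {a,b,c}"] by auto
qed

section \<open>Integrals over triangles\<close>

lemma absolutely_integrable_on_compact:
  fixes f :: "'a::euclidean_space \<Rightarrow> real"
  assumes "compact S" "continuous_on S f"
  shows "f absolutely_integrable_on S"
proof -
  have i: "integrable lborel (\<lambda>x. indicat_real S x *\<^sub>R f x)"
    using assms by (rule borel_integrable_compact)
  then show ?thesis
    unfolding set_integrable_def using integrable_completion[of _ lborel] borel_measurable_integrable by blast
qed

lemma integrable_on_compact:
  fixes f :: "'a::euclidean_space \<Rightarrow> real"
  assumes "compact S" "continuous_on S f"
  shows "f integrable_on S"
  using absolutely_integrable_on_compact[OF assms] set_lebesgue_integral_eq_integral(1) by blast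

text \<open>
  A nonnegative continuous function with zero integral vanishes on every box inside \<open>S\<close>, hence
  on the interior of \<open>S\<close> and, by continuity, on its closure.
\<close>

lemma integral_zero_imp_zero:
  fixes f :: "'a::euclidean_space \<Rightarrow> real"
  assumes S: "compact S" "S \<subseteq> closure (interior S)" and f: "continuous_on S f"
    and nonneg: "\<And>x. x \<in> S \<Longrightarrow> 0 \<le> f x" and zero: "integral S f = 0" and x: "x \<in> S"
  shows "f x = 0"
proof -
  have int0: "f y = 0" if "y \<in> interior S" for y
  proof -
    obtain a b where ab: "y \<in> box a b" "cbox a b \<subseteq> interior S"
      by (rule open_contains_cbox[OF open_interior \<open>y \<in> interior S\<close>])
    have sub: "cbox a b \<subseteq> S" using ab(2) interior_subset by blast
    have cb: "continuous_on (cbox a b) f" using continuous_on_subset[OF f sub] .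
    have "integral (cbox a b) f \<le> integral S f"
      using nonneg by (intro integral_subset_le sub integrable_on_compact S f compact_cbox cb) auto
    moreover have "0 \<le> integral (cbox a b) f"
      using nonneg sub by (intro integral_nonneg integrable_on_compact compact_cbox cb) auto
    ultimately have "integral (cbox a b) f = 0" using zero by simp
    moreover have "y \<in> cbox a b" using ab(1) box_subset_cbox by blast
    ultimately show ?thesis
      using integral_cbox_eq_0_iff[OF cb] ab(1) nonneg sub by blast
  qed
  have "closure (interior S) = S"
    using S closure_minimal[OF interior_subset[of S] compact_imp_closed[OF S(1)]] by blast
  then show ?thesis
    using continuous_constant_on_closure[of "interior S" f 0 x] f int0 x by simp
qed

text \<open>
  The affine map that exchanges two vertices of a triangle and fixes the third maps the triangle
  onto itself. It therefore preserves area, and it exchanges the two barycentric coordinates.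
\<close>

lemma triangle_bary_integral_swap:
  assumes o: "orient a b c \<noteq> 0"
  defines "T \<equiv> convex hull {a, b, c}"
  shows "integral T (interp a b c 1 0 0) = integral T (interp a b c 0 1 0)"
proof -
  define \<delta> where "\<delta> x = interp a b c 0 1 0 x - interp a b c 1 0 0 x" for x
  have aff: "affine_fun \<delta>" unfolding \<delta>_def by (intro affine_fun_diff affine_fun_interp)
  obtain n d where nd: "\<And>x. \<delta> x = n \<bullet> x + d" using aff by (rule affine_funE) blast
  \<comment> \<open>The affine involution that exchanges \<open>a\<close> and \<open>b\<close> and fixes \<open>c\<close>; its linear part is \<open>L\<close>.\<close>
  define g where "g x = x + \<delta> x *\<^sub>R (a - b)" for x
  define L where "L x = x + (n \<bullet> x) *\<^sub>R (a - b)" for x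
  have \<delta>v: "\<delta> a = -1" "\<delta> b = 1" "\<delta> c = 0"
    using interp_vertices[OF o] by (simp_all add: \<delta>_def)
  have g_comb: "g (u *\<^sub>R a + v *\<^sub>R b + w *\<^sub>R c) = v *\<^sub>R a + u *\<^sub>R b + w *\<^sub>R c"
    if "u + v + w = 1" for u v w
    unfolding g_def affine_fun_combination[OF aff that] \<delta>v by (simp add: algebra_simps)
  have gT: "g x \<in> T" and gg: "g (g x) = x" and swap: "interp a b c 1 0 0 (g x) = interp a b c 0 1 0 x"
    if x: "x \<in> T" for x
  proof -
    obtain u v w where uvw: "0 \<le> u" "0 \<le> v" "0 \<le> w" "u + v + w = 1"
      and xeq: "x = u *\<^sub>R a + v *\<^sub>R b + w *\<^sub>R c"
      using x unfolding T_def convex_hull_3 by blast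
    have gx: "g x = v *\<^sub>R a + u *\<^sub>R b + w *\<^sub>R c" unfolding xeq by (rule g_comb[OF uvw(4)])
    have s: "v + u + w = 1" using uvw(4) by simp
    show "g (g x) = x" using g_comb[OF s] unfolding gx[symmetric] xeq[symmetric] .
    show "g x \<in> T" unfolding gx T_def convex_hull_3 using uvw s by blast
    show "interp a b c 1 0 0 (g x) = interp a b c 0 1 0 x"
      unfolding gx affine_fun_combination[OF affine_fun_interp s]
      unfolding xeq affine_fun_combination[OF affine_fun_interp uvw(4)]
      using interp_vertices[OF o] by simp
  qed
  have img: "g ` T = T" using gT gg by (metis image_subset_iff subset_antisym subsetI rev_image_eqI)
  have inj: "inj_on g T" using gg by (metis inj_onI)
  have "linear L" unfolding L_def
    by (intro linearI) (simp_all add: inner_add_right scaleR_add_left algebra_simps)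
  then have bl: "bounded_linear L" by (simp add: linear_conv_bounded_linear)
  have gL: "g = (\<lambda>x. L x + d *\<^sub>R (a - b))"
    by (simp add: fun_eq_iff g_def L_def nd scaleR_add_left)
  have der: "(g has_derivative L) (at x within T)" for x
    unfolding gL using has_derivative_add[OF bounded_linear_imp_has_derivative[OF bl] has_derivative_const]
    by simp
  have cT: "compact T" unfolding T_def by (intro finite_imp_compact_convex_hull) simp
  have lm: "T \<in> lmeasurable" by (rule lmeasurable_compact[OF cT])
  define D where "D = \<bar>det (matrix L)\<bar>"
  have cov: "integral T (\<lambda>x. D * f (g x)) = integral T f" if "continuous_on T f" for f :: "real^2 \<Rightarrow> real"
  proof -
    \<comment> \<open>The change of variables theorem concerns vector-valued functions, so \<open>f\<close> takes its values
      in the one-dimensional space.\<close>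
    have fa: "(\<lambda>x. vec (f x) :: real^1) absolutely_integrable_on T"
      by (simp add: absolutely_integrable_on_1_iff absolutely_integrable_on_compact cT that)
    have "integral T (\<lambda>x. D *\<^sub>R (vec (f (g x)) :: real^1)) = integral T (\<lambda>x. vec (f x))"
      using has_absolute_integral_change_of_variables[OF _ der inj,
          of "\<lambda>x. vec (f x) :: real^1" "integral T (\<lambda>x. vec (f x))"]
        fa lm unfolding D_def img by (simp add: fmeasurableD)
    then show ?thesis unfolding integral_on_1_eq by (simp add: vec_eq_iff)
  qed
  \<comment> \<open>Applied to the constant one, the change of variables compares the area of \<open>T\<close> with itself.\<close>
  have "integral T (\<lambda>x. D) = integral T (\<lambda>x. 1)" using cov[of "\<lambda>x. 1"] by simp
  moreover have "integral T (\<lambda>x. D) = D * integral T (\<lambda>x. 1)"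
    using integral_mult_right[of T D "\<lambda>x. 1"] by simp
  ultimately have "D * measure lebesgue T = measure lebesgue T"
    unfolding lmeasure_integral[OF lm] by simp
  moreover have "measure lebesgue T \<noteq> 0"
    using triangle_interior[OF o] lm negligible_convex_interior[of T]
    by (simp add: T_def negligible_iff_measure0)
  ultimately have "D = 1" by simp
  then have "integral T (interp a b c 1 0 0) = integral T (\<lambda>x. interp a b c 1 0 0 (g x))"
    using cov[OF affine_fun_continuous_on[OF affine_fun_interp]] by simp
  also have "\<dots> = integral T (interp a b c 0 1 0)"
    using swap by (intro integral_cong) auto
  finally show ?thesis .
qed

lemma interp_rotate: "interp b c a \<beta> \<gamma> \<alpha> = interp a b c \<alpha> \<beta> \<gamma>"
  by (simp add: interp_def fun_eq_iff orient_rotate[of b c a] add.commute add.left_commute)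

text \<open>
  The three barycentric coordinates add up to one and have equal integrals by symmetry, so each
  of them integrates to a third of the area.
\<close>

lemma triangle_integral:
  assumes o: "orient a b c \<noteq> 0" and f: "affine_fun f"
  shows "3 * integral (convex hull {a, b, c}) f = measure lebesgue (convex hull {a, b, c}) * (f a + f b + f c)"
proof -
  define T where "T = convex hull {a, b, c}"
  have cT: "compact T" unfolding T_def by (intro finite_imp_compact_convex_hull) simp
  have int: "h integrable_on T" if "affine_fun h" for h
    by (intro integrable_on_compact cT affine_fun_continuous_on that)
  define I where "I = integral T (interp a b c 1 0 0)"
  have T': "convex hull {b, c, a} = T" by (simp add: T_def insert_commute)
  have I2: "integral T (interp a b c 0 1 0) = I"
    using triangle_bary_integral_swap[OF o] unfolding I_def T_def by simp
  have "orient b c a \<noteq> 0" using o by (simp add: orient_rotate)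
  then have I3: "integral T (interp a b c 0 0 1) = I"
    using triangle_bary_integral_swap[of b c a] I2
    unfolding interp_rotate[of b c a 1 0 0] interp_rotate[of b c a 0 1 0] T' by simp
  have comb: "integral T h = (h a + h b + h c) * I" if h: "affine_fun h" for h
  proof -
    have "h x = h a * interp a b c 1 0 0 x + h b * interp a b c 0 1 0 x + h c * interp a b c 0 0 1 x" for x
    proof -
      have "h x = interp a b c (h a) (h b) (h c) x" by (rule interp_unique[OF h o])
      then show ?thesis by (simp add: interp_def add_divide_distrib mult.commute)
    qed
    then have "integral T h = integral T (\<lambda>x. h a * interp a b c 1 0 0 x + h b * interp a b c 0 1 0 x + h c * interp a b c 0 0 1 x)"
      by (rule integral_cong)
    also have "\<dots> = h a * I + h b * I + h c * I"
      by (simp add: integral_add int affine_fun_add affine_fun_cmult affine_fun_interp I2 I3 I_def[symmetric])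
    finally show ?thesis by (simp add: algebra_simps)
  qed
  have "measure lebesgue T = 3 * I"
    using comb[OF affine_fun_const[of 1]] lmeasure_integral[OF lmeasurable_compact[OF cT]] by simp
  then show ?thesis using comb[OF f] unfolding T_def by simp
qed

section \<open>Labelled convex polygons\<close>

locale convex_polygon =
  fixes Q :: "(real^2) set" and p :: "'v::finite \<Rightarrow> real^2"
  assumes labelled: "labelled_convex_polygon Q p"
begin

abbreviation tri :: "'v \<Rightarrow> 'v \<Rightarrow> 'v \<Rightarrow> (real^2) set" where
  "tri i j k \<equiv> convex hull {p i, p j, p k}"

abbreviation lift :: "real^'v \<Rightarrow> 'v \<Rightarrow> 'v \<Rightarrow> 'v \<Rightarrow> real^2 \<Rightarrow> real" where
  "lift w i j k \<equiv> interp (p i) (p j) (p k) (w$i) (w$j) (w$k)"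

lemma extreme_iff: "x extreme_point_of Q \<longleftrightarrow> (\<exists>i. x = p i)"
  using labelled unfolding labelled_convex_polygon_def bij_betw_def by auto

lemma inj_p: "p i = p j \<longleftrightarrow> i = j"
  using labelled unfolding labelled_convex_polygon_def bij_betw_def by (auto dest: injD)

lemma Q_polytope: "polytope Q"
  using labelled unfolding labelled_convex_polygon_def by simp

lemma Q_hull: "Q = convex hull (range p)"
proof -
  have "Q = convex hull {x. x extreme_point_of Q}"
    using Q_polytope by (intro Krein_Milman_Minkowski polytope_imp_compact polytope_imp_convex)
  also have "{x. x extreme_point_of Q} = range p" by (auto simp: extreme_iff)
  finally show ?thesis .
qed

lemma convex_Q: "convex Q" and compact_Q: "compact Q" and closed_Q: "closed Q"
  using Q_polytope polytope_imp_convex polytope_imp_compact polytope_imp_closed by auto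

lemma vertex_in_Q: "p i \<in> Q"
  unfolding Q_hull by (simp add: hull_inc)

lemma interior_Q: "interior Q \<noteq> {}"
proof -
  have a: "aff_dim Q = 2" using labelled unfolding labelled_convex_polygon_def by simp
  then show ?thesis
    using rel_interior_interior[of Q] rel_interior_eq_empty[OF convex_Q] aff_dim_eq_full[of Q] vertex_in_Q
    by auto
qed

lemma closure_interior_Q: "closure (interior Q) = Q"
  using convex_closure_interior[OF convex_Q interior_Q] closed_Q by simp

lemma vertex_between:
  assumes "x \<in> Q" "y \<in> Q" "p i \<in> closed_segment x y"
  shows "p i = x \<or> p i = y"
  using assms extreme_iff[of "p i"] unfolding extreme_point_of_def open_segment_def by auto

text \<open>
  A vertex of \<open>Q\<close> is an extreme point, so the line through two vertices leaves \<open>Q\<close> at both of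
  them. This is how convex position enters all arguments about diagonals.
\<close>

lemma line_Int_Q:
  assumes "i \<noteq> j" "x \<in> Q" "orient (p i) (p j) x = 0"
  shows "x \<in> closed_segment (p i) (p j)"
proof -
  have "between (p j, x) (p i) \<or> between (x, p i) (p j) \<or> between (p i, p j) x"
    using assms(3) collinear_between_cases[of "p i" "p j" x] by (simp add: orient_eq_0_iff_collinear)
  then show ?thesis
    unfolding between_mem_segment
    using vertex_between[of "p j" x i] vertex_between[of x "p i" j] vertex_in_Q assms(1,2) inj_p
    by (metis ends_in_segment)
qed

lemma orient_vertices:
  assumes "distinct [i, j, k]" shows "orient (p i) (p j) (p k) \<noteq> 0"
proof
  assume "orient (p i) (p j) (p k) = 0"
  then have "p k \<in> closed_segment (p i) (p j)" using line_Int_Q assms vertex_in_Q by auto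
  then show False using vertex_between vertex_in_Q inj_p assms by (metis distinct_length_2_or_more)
qed

lemma tri_subset_Q: "tri i j k \<subseteq> Q"
  unfolding Q_hull by (rule hull_mono) auto

lemma triangulation_cell:
  assumes "polygon_triangulation Q t" "\<sigma> \<in> t"
  shows "\<exists>i j k. distinct [i, j, k] \<and> \<sigma> = tri i j k"
proof -
  have "2 simplex \<sigma>" using assms unfolding polygon_triangulation_def by blast
  then obtain C where C: "\<not> affine_dependent C" "card C = 3" "\<sigma> = convex hull C"
    unfolding simplex_def by auto
  obtain a b c where abc: "C = {a, b, c}" "a \<noteq> b" "a \<noteq> c" "b \<noteq> c"
    using C(2) unfolding card_3_iff by auto
  have "\<exists>i. x = p i" if "x \<in> C" for x
  proof -
    have "x extreme_point_of \<sigma>" using extreme_point_of_convex_hull_affine_independent C that by auto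
    then show ?thesis using assms unfolding polygon_triangulation_def by (auto simp: extreme_iff)
  qed
  then have "\<exists>i. a = p i" "\<exists>j. b = p j" "\<exists>k. c = p k" using abc(1) by simp_all
  then obtain i j k where "a = p i" "b = p j" "c = p k" by (elim exE)
  then show ?thesis using abc C(3) by (intro exI[of _ i] exI[of _ j] exI[of _ k]) auto
qed

lemma finite_triangulation: "polygon_triangulation Q t \<Longrightarrow> finite t"
  unfolding polygon_triangulation_def triangulation_def by blast

lemma finite_triangulations: "finite {t. polygon_triangulation Q t}"
proof -
  have "{t. polygon_triangulation Q t} \<subseteq> Pow (range (\<lambda>(i,j,k). tri i j k))"
    using triangulation_cell by fastforce
  then show ?thesis by (rule finite_subset) simp
qed

lemma tri_extreme: "distinct [i, j, k] \<Longrightarrow> p q extreme_point_of tri i j k \<longleftrightarrow> q \<in> {i, j, k}"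
  using extreme_point_of_convex_hull_affine_independent[OF
      triangle_affine_independent(1)[OF orient_vertices[of i j k]], of "p q"] inj_p
  by simp

lemma vertex_in_tri: "distinct [i, j, k] \<Longrightarrow> p q \<in> tri i j k \<longleftrightarrow> q \<in> {i, j, k}"
proof
  assume d: "distinct [i, j, k]" and q: "p q \<in> tri i j k"
  have "p q extreme_point_of tri i j k"
    using extreme_iff[of "p q"] q tri_subset_Q[of i j k] unfolding extreme_point_of_def by blast
  then show "q \<in> {i, j, k}" using tri_extreme[OF d] by simp
qed (auto intro: hull_inc)

section \<open>Lower triangulations\<close>

text \<open>
  The triangle \<open>i j k\<close> lifted to the heights \<open>w\<close> spans a plane that passes below all lifted
  vertices; these are the lower facets of the lifted polygon.
\<close>

definition lower :: "real^'v \<Rightarrow> 'v \<Rightarrow> 'v \<Rightarrow> 'v \<Rightarrow> bool" where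
  "lower w i j k \<longleftrightarrow> distinct [i, j, k] \<and> (\<forall>q. lift w i j k (p q) \<le> w$q)"

definition lower_cells :: "real^'v \<Rightarrow> (real^2) set set" where
  "lower_cells w = {tri i j k | i j k. lower w i j k}"

lemma finite_lower_cells: "finite (lower_cells w)"
proof (rule finite_subset)
  show "lower_cells w \<subseteq> range (\<lambda>(i,j,k). tri i j k)" unfolding lower_cells_def by fastforce
qed simp

lemma lift_combination:
  assumes "distinct [i, j, k]" "u + v + r = 1"
  shows "lift w i j k (u *\<^sub>R p i + v *\<^sub>R p j + r *\<^sub>R p k) = u * w$i + v * w$j + r * w$k"
  using affine_fun_combination[OF affine_fun_interp assms(2)]
    interp_vertices[OF orient_vertices[OF assms(1)]] by simp

text \<open>
  One pivot step of the simplex method. A point \<open>x\<close> in the interior of a triangle is moved to a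
  triangle in which a vertex \<open>q\<close> lying below the lifted plane replaces \<open>i\<close>. Maximality of
  the ratio \<open>a / u\<close> keeps all barycentric coordinates of \<open>x\<close> nonnegative, and because \<open>u\<close> is
  positive the lifted height above \<open>x\<close> strictly drops.
\<close>

lemma pivot:
  assumes d: "distinct [i, j, k, q]"
    and x: "x = u *\<^sub>R p i + v *\<^sub>R p j + r *\<^sub>R p k" "0 < u" "0 < v" "0 < r" "u + v + r = 1"
    and q: "p q = a *\<^sub>R p i + b *\<^sub>R p j + c *\<^sub>R p k" "a + b + c = 1"
    and le: "0 < a / u" "b / v \<le> a / u" "c / r \<le> a / u"
    and below: "w$q < a * w$i + b * w$j + c * w$k"
  shows "x \<in> tri q j k \<and> lift w q j k x < u * w$i + v * w$j + r * w$k"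
proof -
  define \<theta> where "\<theta> = u / a"
  have a: "a > 0" using le(1) x(2) by (simp add: zero_less_divide_iff)
  have \<theta>: "\<theta> > 0" "\<theta> * a = u" using a x(2) by (simp_all add: \<theta>_def)
  have nonneg: "0 \<le> v - \<theta> * b" "0 \<le> r - \<theta> * c"
    using le(2,3) a x(2-4) by (simp_all add: \<theta>_def field_simps)
  have sum: "\<theta> + (v - \<theta> * b) + (r - \<theta> * c) = 1"
  proof -
    have "\<theta> * b + \<theta> * c = \<theta> * (a + b + c) - \<theta> * a" by (simp add: algebra_simps)
    then show ?thesis using q(2) \<theta>(2) x(5) by simp
  qed
  have "\<theta> *\<^sub>R p q = u *\<^sub>R p i + (\<theta> * b) *\<^sub>R p j + (\<theta> * c) *\<^sub>R p k"
    unfolding q(1) by (simp add: scaleR_add_right \<theta>(2))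
  then have xq: "x = \<theta> *\<^sub>R p q + (v - \<theta> * b) *\<^sub>R p j + (r - \<theta> * c) *\<^sub>R p k"
    unfolding x(1) by (simp add: algebra_simps)
  have "lift w q j k x = \<theta> * w$q + (v - \<theta> * b) * w$j + (r - \<theta> * c) * w$k"
    unfolding xq using d sum by (intro lift_combination) auto
  also have "\<dots> = u * w$i + v * w$j + r * w$k + \<theta> * (w$q - (a * w$i + b * w$j + c * w$k))"
    unfolding \<theta>(2)[symmetric] by (simp add: algebra_simps)
  also have "\<dots> < u * w$i + v * w$j + r * w$k"
    using mult_pos_neg[OF \<theta>(1), of "w$q - (a * w$i + b * w$j + c * w$k)"] below by simp
  finally have "lift w q j k x < u * w$i + v * w$j + r * w$k" .
  moreover have "x \<in> tri q j k"
    unfolding convex_hull_3 xq using \<theta>(1) nonneg sum by (intro CollectI exI conjI) (rule refl | simp)+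
  ultimately show ?thesis by blast
qed

text \<open>
  Among the finitely many triangles that contain \<open>x\<close>, the one with the lowest lifted height above
  \<open>x\<close> is lower, since otherwise a pivot step would produce a still lower one. Being off all
  segments between vertices makes the barycentric coordinates of \<open>x\<close> positive.
\<close>

lemma lower_cells_cover_generic_point:
  assumes x: "x \<in> Q" and off: "\<And>i j. x \<notin> closed_segment (p i) (p j)"
  shows "\<exists>i j k. lower w i j k \<and> x \<in> tri i j k"
proof -
  define C where "C = {(i, j, k). distinct [i, j, k] \<and> x \<in> tri i j k}"
  have "C \<noteq> {}"
  proof -
    obtain S where S: "finite S" "S \<subseteq> range p" "card S \<le> 3" "x \<in> convex hull S"
      using x unfolding Q_hull caratheodory[of "range p"] by auto
    have "card S \<noteq> 0" using S by auto
    moreover have "card S \<noteq> 1"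
    proof
      assume "card S = 1"
      obtain y where "S = {y}" using \<open>card S = 1\<close> by (rule card_1_singletonE)
      then obtain i where "S = {p i}" using S(2) by auto
      then show False using S(4) off[of i i] by simp
    qed
    moreover have "card S \<noteq> 2"
    proof
      assume "card S = 2"
      obtain y z where "S = {y, z}" using \<open>card S = 2\<close> unfolding card_2_iff by blast
      then obtain i j where "S = {p i, p j}" using S(2) by auto
      then show False using S(4) off[of i j] by (simp add: segment_convex_hull)
    qed
    ultimately have "card S = 3" using S(3) by linarith
    then obtain y1 y2 y3 where y: "S = {y1, y2, y3}" "y1 \<noteq> y2" "y1 \<noteq> y3" "y2 \<noteq> y3"
      unfolding card_3_iff by blast
    then have "\<exists>i. y1 = p i" "\<exists>j. y2 = p j" "\<exists>k. y3 = p k" using S(2) by auto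
    then obtain i j k where "y1 = p i" "y2 = p j" "y3 = p k" by (elim exE)
    then have "S = {p i, p j, p k}" "distinct [i, j, k]" using y by auto
    then have "(i, j, k) \<in> C" using S(4) unfolding C_def by auto
    then show ?thesis by blast
  qed
  moreover have "finite C" by simp
  ultimately obtain t0 where t0: "t0 \<in> C"
    and min0: "\<And>s. s \<in> C \<Longrightarrow> (case t0 of (i,j,k) \<Rightarrow> lift w i j k x) \<le> (case s of (i,j,k) \<Rightarrow> lift w i j k x)"
    using ex_min_if_finite[of "(\<lambda>(i,j,k). lift w i j k x) ` C"]
    by (force simp: not_less)
  obtain i j k where t0_eq: "t0 = (i, j, k)" by (cases t0)
  then have d: "distinct [i, j, k]" and xt: "x \<in> tri i j k" using t0 unfolding C_def by auto
  have min: "lift w i j k x \<le> lift w i' j' k' x" if "distinct [i', j', k']" "x \<in> tri i' j' k'" for i' j' k'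
    using min0[of "(i', j', k')"] that t0_eq unfolding C_def by auto
  obtain u v r where uvr: "0 \<le> u" "0 \<le> v" "0 \<le> r" "u + v + r = 1"
    and xeq: "x = u *\<^sub>R p i + v *\<^sub>R p j + r *\<^sub>R p k"
    using xt unfolding convex_hull_3 by blast
  have seg: "(s *\<^sub>R p a + s' *\<^sub>R p b) \<noteq> x" if "0 \<le> s" "0 \<le> s'" "s + s' = 1" for s s' a b
    using off[of a b] that unfolding segment_convex_hull convex_hull_2 by blast
  have "u \<noteq> 0" using seg[of v r j k] uvr xeq by auto
  moreover have "v \<noteq> 0" using seg[of u r i k] uvr xeq by auto
  moreover have "r \<noteq> 0" using seg[of u v i j] uvr xeq by auto
  ultimately have pos: "0 < u" "0 < v" "0 < r" using uvr by auto
  have "lower w i j k"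
  proof (rule ccontr)
    assume "\<not> lower w i j k"
    then obtain q where q: "w$q < lift w i j k (p q)" using d unfolding lower_def by (meson not_less)
    have dq: "q \<noteq> i" "q \<noteq> j" "q \<noteq> k" using q interp_vertices[OF orient_vertices[OF d]] by auto
    define D a b c where "D = orient (p i) (p j) (p k)" and "a = orient (p j) (p k) (p q) / D"
      and "b = orient (p k) (p i) (p q) / D" and "c = orient (p i) (p j) (p q) / D"
    have abc: "f (p q) = a * f (p i) + b * f (p j) + c * f (p k)" if "affine_fun f" for f
      using interp_unique[OF that orient_vertices[OF d], of "p q"]
      by (simp add: interp_def a_def b_def c_def D_def add_divide_distrib)
    have s1: "a + b + c = 1" using abc[OF affine_fun_const[of 1]] by simp
    have pq: "p q = a *\<^sub>R p i + b *\<^sub>R p j + c *\<^sub>R p k"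
      unfolding vec_eq_iff
    proof
      fix m
      have "affine_fun (\<lambda>x. x $ m)"
        by (rule affine_funI[of _ "axis m 1" 0]) (simp add: inner_axis')
      from abc[OF this] show "p q $ m = (a *\<^sub>R p i + b *\<^sub>R p j + c *\<^sub>R p k) $ m" by simp
    qed
    have below: "w$q < a * w$i + b * w$j + c * w$k"
      using q lift_combination[OF d s1] pq by simp
    have L: "lift w i j k x = u * w$i + v * w$j + r * w$k"
      using lift_combination[OF d uvr(4)] xeq by simp
    have "0 < a / u \<or> 0 < b / v \<or> 0 < c / r"
      using s1 pos by (smt (verit) divide_pos_pos)
    \<comment> \<open>The vertex with the largest ratio leaves the triangle; this ratio is positive because
      \<open>a\<close>, \<open>b\<close>, \<open>c\<close> have sum one.\<close>
    then consider "0 < a / u" "b / v \<le> a / u" "c / r \<le> a / u"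
      | "0 < b / v" "a / u \<le> b / v" "c / r \<le> b / v"
      | "0 < c / r" "a / u \<le> c / r" "b / v \<le> c / r" by linarith
    then show False
    proof cases
      case 1
      have "x \<in> tri q j k \<and> lift w q j k x < u * w$i + v * w$j + r * w$k"
        by (rule pivot[OF _ xeq pos uvr(4) pq s1 1 below]) (use d dq in auto)
      then show False using min[of q j k] d dq L by auto
    next
      case 2
      have "x \<in> tri q i k \<and> lift w q i k x < v * w$j + u * w$i + r * w$k"
        by (rule pivot[of j i k q x v u r b a c])
          (use d dq xeq pos uvr(4) pq s1 2 below in \<open>auto simp: add.commute add.left_commute\<close>)
      then show False using min[of q i k] d dq L by auto
    next
      case 3
      have "x \<in> tri q i j \<and> lift w q i j x < r * w$k + u * w$i + v * w$j"
        by (rule pivot[of k i j q x r u v c a b])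
          (use d dq xeq pos uvr(4) pq s1 3 below in \<open>auto simp: add.commute add.left_commute\<close>)
      then show False using min[of q i j] d dq L by auto
    qed
  qed
  then show ?thesis using xt by blast
qed

text \<open>
  The points off all segments are dense in \<open>Q\<close>, and a finite union of triangles is closed.
\<close>

lemma lower_cells_cover: "\<Union>(lower_cells w) = Q"
proof
  show "\<Union>(lower_cells w) \<subseteq> Q" unfolding lower_cells_def using tri_subset_Q by blast
  define S where "S = (\<Union>(i,j)\<in>UNIV. closed_segment (p i) (p j))"
  have S: "negligible S" unfolding S_def
  proof (intro negligible_Union, goal_cases)
    case (2 c)
    then obtain i j where "c = closed_segment (p i) (p j)" by auto
    then show ?case
      by (simp add: negligible_convex_interior interior_closed_segment_ge2)
  qed simp
  have cl: "closed (\<Union>(lower_cells w))"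
    by (intro closed_Union finite_lower_cells)
      (auto simp: lower_cells_def intro!: compact_imp_closed finite_imp_compact_convex_hull)
  have "interior Q \<subseteq> \<Union>(lower_cells w)"
  proof (rule ccontr)
    assume "\<not> interior Q \<subseteq> \<Union>(lower_cells w)"
    then have ne: "interior Q - \<Union>(lower_cells w) \<noteq> {}" by blast
    have "open (interior Q - \<Union>(lower_cells w))" using cl by (simp add: open_Diff)
    then have "\<not> negligible (interior Q - \<Union>(lower_cells w))"
      using ne open_not_negligible by blast
    then obtain x where x: "x \<in> interior Q" "x \<notin> \<Union>(lower_cells w)" "x \<notin> S"
      using S negligible_subset by blast
    have "\<exists>i j k. lower w i j k \<and> x \<in> tri i j k"
      using x interior_subset[of Q] unfolding S_def by (intro lower_cells_cover_generic_point) auto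
    then show False using x(2) unfolding lower_cells_def by blast
  qed
  then show "Q \<subseteq> \<Union>(lower_cells w)"
    using closure_minimal[OF _ cl] closure_interior_Q by metis
qed

text \<open>
  No four lifted vertices lie in a plane.
\<close>

definition generic :: "real^'v \<Rightarrow> bool" where
  "generic w \<longleftrightarrow> (\<forall>i j k q. distinct [i, j, k, q] \<longrightarrow> lift w i j k (p q) \<noteq> w$q)"

lemma lower_le_on_lower_cell:
  assumes l: "lower w i j k" and d: "distinct [i', j', k']" and x: "x \<in> tri i' j' k'"
  shows "lift w i j k x \<le> lift w i' j' k' x"
proof -
  have "0 \<le> lift w i' j' k' x - lift w i j k x"
    using interp_vertices[OF orient_vertices[OF d]] l unfolding lower_def
    by (intro affine_fun_nonneg_hull[OF affine_fun_diff[OF affine_fun_interp affine_fun_interp] _ x]) auto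
  then show ?thesis by simp
qed

text \<open>
  For two lower triangles, the difference of their affine interpolants is nonnegative on the first
  and zero exactly on the common part, because by genericity a lower plane touches the lifted
  vertices only in its own three. The intersection is therefore an exposed face.
\<close>

lemma generic_lower_cells_triangulation:
  assumes g: "generic w"
  shows "polygon_triangulation Q (lower_cells w)"
  unfolding polygon_triangulation_def triangulation_def
proof (intro conjI ballI allI impI)
  show "finite (lower_cells w)" by (rule finite_lower_cells)
  show "\<Union>(lower_cells w) = Q" by (rule lower_cells_cover)
  show s: "2 simplex \<sigma>" if "\<sigma> \<in> lower_cells w" for \<sigma>
    using that triangle_simplex orient_vertices unfolding lower_cells_def lower_def by blast
  then show "\<exists>n. n simplex \<sigma>" if "\<sigma> \<in> lower_cells w" for \<sigma> using that by blast
  show "x extreme_point_of Q" if "\<sigma> \<in> lower_cells w" "x extreme_point_of \<sigma>" for \<sigma> x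
    using that extreme_point_of_convex_hull unfolding lower_cells_def extreme_iff by blast
  fix \<sigma> \<tau> assume "\<sigma> \<in> lower_cells w \<and> \<tau> \<in> lower_cells w"
  then obtain i j k i' j' k' where \<sigma>: "\<sigma> = tri i j k" "lower w i j k"
    and \<tau>: "\<tau> = tri i' j' k'" "lower w i' j' k'" unfolding lower_cells_def by blast
  have d: "distinct [i, j, k]" and d': "distinct [i', j', k']" using \<sigma> \<tau> lower_def by auto
  define f where "f x = lift w i j k x - lift w i' j' k' x" for x
  have f: "affine_fun f" unfolding f_def by (intro affine_fun_diff affine_fun_interp)
  obtain n e where ne: "\<And>x. f x = n \<bullet> x + e" using f by (rule affine_funE) blast
  have pos: "0 \<le> f x" if "x \<in> \<sigma>" for x
    using lower_le_on_lower_cell[OF \<tau>(2) d] that \<sigma>(1) unfolding f_def by simp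
  have zero: "f x = 0" if "x \<in> \<sigma>" "x \<in> \<tau>" for x
    using lower_le_on_lower_cell[OF \<tau>(2) d] lower_le_on_lower_cell[OF \<sigma>(2) d'] that \<sigma>(1) \<tau>(1)
    unfolding f_def by (simp add: order_antisym)
  have mem: "x \<in> \<tau>" if x: "x \<in> \<sigma>" "f x = 0" for x
  proof -
    have "x \<in> convex hull {s \<in> {p i, p j, p k}. f s = 0}"
      using x pos unfolding \<sigma>(1) by (intro affine_fun_zero_hull[OF f]) (auto intro: hull_inc)
    moreover have "{s \<in> {p i, p j, p k}. f s = 0} \<subseteq> {p i', p j', p k'}"
    proof (intro subsetI, rule ccontr)
      fix s assume s0: "s \<in> {s \<in> {p i, p j, p k}. f s = 0}" and s1: "s \<notin> {p i', p j', p k'}"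
      then have s: "s \<in> {p i, p j, p k}" "f s = 0" by auto
      then obtain q where q: "s = p q" "q \<in> {i, j, k}" by blast
      then have "lift w i j k (p q) = w$q"
        using interp_vertices[OF orient_vertices[OF d]] by auto
      then have "lift w i' j' k' (p q) = w$q" using s(2) q(1) unfolding f_def by simp
      moreover have "distinct [i', j', k', q]" using d' s1 q by auto
      ultimately show False using g unfolding generic_def by blast
    qed
    ultimately show ?thesis unfolding \<tau>(1) using hull_mono by blast
  qed
  have "(- n) \<bullet> x = e \<longleftrightarrow> f x = 0" for x using ne[of x] by auto
  then have "\<sigma> \<inter> \<tau> = \<sigma> \<inter> {x. (- n) \<bullet> x = e}" using zero mem by auto
  also have "\<dots> face_of \<sigma>"
  proof (rule face_of_Int_supporting_hyperplane_le)
    show "convex \<sigma>" unfolding \<sigma>(1) by (rule convex_convex_hull)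
    show "- n \<bullet> x \<le> e" if "x \<in> \<sigma>" for x using pos[OF that] ne[of x] by simp
  qed
  finally show "\<sigma> \<inter> \<tau> face_of \<sigma>" .
qed

text \<open>
  Each coincidence of four lifted vertices in a plane is a hyperplane in the space of heights, and
  finitely many hyperplanes form a null set.
\<close>

lemma generic_dense:
  assumes "open U" "U \<noteq> {}"
  shows "\<exists>w\<in>U. generic w"
proof -
  define H :: "'v \<times> 'v \<times> 'v \<times> 'v \<Rightarrow> (real^'v) set" where
    "H = (\<lambda>(i,j,k,q). if distinct [i,j,k,q] then {w. lift w i j k (p q) = w$q} else {})"
  have "negligible (H s)" for s
  proof -
    obtain i j k q where s: "s = (i, j, k, q)" by (cases s) 
    show ?thesis
    proof (cases "distinct [i, j, k, q]")
      case True
      define D where "D = orient (p i) (p j) (p k)"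
      define a :: "real^'v" where "a = (orient (p j) (p k) (p q) / D) *\<^sub>R axis i 1
        + (orient (p k) (p i) (p q) / D) *\<^sub>R axis j 1 + (orient (p i) (p j) (p q) / D) *\<^sub>R axis k 1 - axis q 1"
      \<comment> \<open>The height of \<open>q\<close> enters the condition with coefficient \<open>-1\<close>, so the equation is
        nontrivial.\<close>
      have "a $ q = -1" using True by (auto simp: a_def axis_def)
      then have "a \<noteq> 0" by auto
      moreover have "H s = {w. a \<bullet> w = 0}"
        using True by (auto simp: s H_def a_def inner_add_left inner_diff_left inner_axis' interp_def D_def add_divide_distrib)
      ultimately show ?thesis using negligible_hyperplane by metis
    qed (auto simp: s H_def)
  qed
  then have "negligible (\<Union>(range H))" by (intro negligible_Union) auto
  then have "\<not> U \<subseteq> \<Union>(range H)" using assms open_not_negligible negligible_subset by blast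
  then obtain w where w: "w \<in> U" "w \<notin> \<Union>(range H)" by blast
  have "generic w"
    unfolding generic_def
  proof (intro allI impI)
    fix i j k q :: 'v assume "distinct [i, j, k, q]"
    moreover have "w \<notin> H (i, j, k, q)" using w(2) by blast
    ultimately show "lift w i j k (p q) \<noteq> w$q" by (simp add: H_def)
  qed
  then show ?thesis using w(1) by blast
qed

lemma closed_lower: "closed {w. lower w i j k}"
proof -
  have "closed {w. \<forall>q. lift w i j k (p q) \<le> w$q}"
    unfolding interp_def divide_inverse
    by (intro closed_Collect_all closed_Collect_le continuous_intros)
  then show ?thesis unfolding lower_def by (cases "distinct [i, j, k]") auto
qed

text \<open>
  For degenerate heights the lower triangles overlap. For a fixed triangulation \<open>t\<close>, the heights
  for which all triangles of \<open>t\<close> are lower form a closed set. There are finitely many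
  triangulations, so the union of these closed sets is closed; it contains the dense set of
  generic heights and is therefore everything.
\<close>

lemma lower_triangulation_exists:
  "\<exists>t. polygon_triangulation Q t \<and> t \<subseteq> lower_cells w"
proof -
  define L where "L t = {w. t \<subseteq> lower_cells w}" for t
  have "closed (L t)" for t
  proof -
    have "L t = (\<Inter>\<sigma>\<in>t. \<Union>(i,j,k)\<in>{(i,j,k). \<sigma> = tri i j k}. {w. lower w i j k})"
      unfolding L_def lower_cells_def by fastforce
    also have "closed \<dots>" using closed_lower by (intro closed_INT ballI closed_UN) auto
    finally show ?thesis .
  qed
  then have cl: "closed (\<Union>t\<in>{t. polygon_triangulation Q t}. L t)"
    using finite_triangulations by (intro closed_UN) auto
  have "- (\<Union>t\<in>{t. polygon_triangulation Q t}. L t) = {}"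
  proof (rule ccontr)
    assume "- (\<Union>t\<in>{t. polygon_triangulation Q t}. L t) \<noteq> {}"
    then obtain w where w: "w \<notin> (\<Union>t\<in>{t. polygon_triangulation Q t}. L t)" "generic w"
      using generic_dense[OF open_Compl[OF cl]] by blast
    then show False using generic_lower_cells_triangulation[OF w(2)] unfolding L_def by blast
  qed
  then show ?thesis unfolding L_def by blast
qed

section \<open>The GKZ vector as an integral\<close>

lemma gkz_inner:
  assumes "finite t"
  shows "gkz_vector p t \<bullet> w = (\<Sum>\<sigma>\<in>t. measure lebesgue \<sigma> * (\<Sum>i | p i extreme_point_of \<sigma>. w$i))"
proof -
  have "gkz_vector p t \<bullet> w = (\<Sum>i\<in>UNIV. \<Sum>\<sigma>\<in>{\<sigma>\<in>t. p i extreme_point_of \<sigma>}. measure lebesgue \<sigma> * w$i)"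
    unfolding gkz_vector_def by (simp add: inner_sum_left inner_axis')
  also have "\<dots> = (\<Sum>\<sigma>\<in>t. \<Sum>i\<in>{i\<in>UNIV. p i extreme_point_of \<sigma>}. measure lebesgue \<sigma> * w$i)"
    using assms by (intro sum.swap_restrict) simp_all
  also have "\<dots> = (\<Sum>\<sigma>\<in>t. measure lebesgue \<sigma> * (\<Sum>i | p i extreme_point_of \<sigma>. w$i))"
    by (simp add: sum_distrib_left)
  finally show ?thesis .
qed

lemma cell_integral:
  assumes "distinct [i, j, k]"
  shows "measure lebesgue (tri i j k) * (\<Sum>q | p q extreme_point_of tri i j k. w$q)
    = 3 * integral (tri i j k) (lift w i j k)"
proof -
  have "{q. p q extreme_point_of tri i j k} = {i, j, k}" using tri_extreme[OF assms] by auto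
  then have "(\<Sum>q | p q extreme_point_of tri i j k. w$q) = w$i + w$j + w$k" using assms by simp
  then show ?thesis
    using triangle_integral[OF orient_vertices[OF assms] affine_fun_interp]
      interp_vertices[OF orient_vertices[OF assms]] by simp
qed

text \<open>
  The intersection is a proper face of one of the two triangles and so has smaller dimension.
\<close>

lemma cells_overlap_negligible:
  assumes t: "polygon_triangulation Q t" and \<sigma>\<tau>: "\<sigma> \<in> t" "\<tau> \<in> t" "\<sigma> \<noteq> \<tau>"
  shows "negligible (\<sigma> \<inter> \<tau>)"
proof -
  have f: "\<sigma> \<inter> \<tau> face_of \<sigma>" "\<tau> \<inter> \<sigma> face_of \<tau>"
    using t \<sigma>\<tau> unfolding polygon_triangulation_def triangulation_def by blast+
  have c: "convex \<sigma>" "convex \<tau>" "aff_dim \<sigma> = 2" "aff_dim \<tau> = 2"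
    using t \<sigma>\<tau> convex_simplex aff_dim_simplex unfolding polygon_triangulation_def by blast+
  have "aff_dim (\<sigma> \<inter> \<tau>) < 2"
  proof (cases "\<sigma> \<inter> \<tau> = \<sigma>")
    case True
    then have "\<tau> \<inter> \<sigma> \<noteq> \<tau>" using \<sigma>\<tau>(3) by blast
    then show ?thesis using face_of_aff_dim_lt[OF c(2) f(2)] c(4) by (simp add: Int_commute)
  next
    case False
    then show ?thesis using face_of_aff_dim_lt[OF c(1) f(1)] c(3) by simp
  qed
  then have "interior (\<sigma> \<inter> \<tau>) = {}" using aff_dim_nonempty_interior[of "\<sigma> \<inter> \<tau>"] by auto
  then show ?thesis using c by (simp add: negligible_convex_interior convex_Int)
qed

lemma integral_over_cells:
  fixes f :: "real^2 \<Rightarrow> real"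
  assumes t: "polygon_triangulation Q t" and f: "continuous_on UNIV f"
  shows "integral Q f = (\<Sum>\<sigma>\<in>t. integral \<sigma> f)"
proof -
  have "(f has_integral (\<Sum>\<sigma>\<in>t. integral \<sigma> f)) (\<Union>t)"
  proof (rule has_integral_Union)
    show "finite t" using finite_triangulation[OF t] .
    show "(f has_integral integral \<sigma> f) \<sigma>" if "\<sigma> \<in> t" for \<sigma>
    proof (intro integrable_integral integrable_on_compact continuous_on_subset[OF f])
      show "compact \<sigma>" using triangulation_cell[OF t that] by (auto intro: finite_imp_compact_convex_hull)
    qed simp
    show "pairwise (\<lambda>S S'. negligible (S \<inter> S')) t"
      using cells_overlap_negligible[OF t] by (simp add: pairwise_def)
  qed
  then show ?thesis using t unfolding polygon_triangulation_def by (simp add: integral_unique)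
qed

text \<open>
  The triangulation \<open>t\<close> refines the regions on which \<open>f\<close> is affine.
\<close>

definition affine_on_cells :: "(real^2 \<Rightarrow> real) \<Rightarrow> (real^2) set set \<Rightarrow> bool" where
  "affine_on_cells f t \<longleftrightarrow> (\<forall>\<sigma>\<in>t. \<exists>a. affine_fun a \<and> (\<forall>x\<in>\<sigma>. f x = a x))"

text \<open>
  On each triangle a convex function lies below the affine function with the same values at the
  vertices, whose integral is the contribution of the triangle to the pairing. Equality of the
  integrals forces the two functions to coincide.
\<close>

lemma gkz_convex_function:
  assumes t: "polygon_triangulation Q t" and f: "convex_on UNIV f" and fw: "\<And>q. f (p q) = w$q"
  shows "3 * integral Q f \<le> gkz_vector p t \<bullet> w"
    and "gkz_vector p t \<bullet> w = 3 * integral Q f \<longleftrightarrow> affine_on_cells f t"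
proof -
  have cont: "continuous_on S f" for S
    using convex_on_continuous[OF open_UNIV f] continuous_on_subset by blast
  have "\<forall>\<sigma>\<in>t. \<exists>s. case s of (i, j, k) \<Rightarrow> distinct [i, j, k] \<and> \<sigma> = tri i j k"
    using triangulation_cell[OF t] by fastforce
  from bchoice[OF this] obtain c
    where c0: "\<forall>\<sigma>\<in>t. case c \<sigma> of (i, j, k) \<Rightarrow> distinct [i, j, k] \<and> \<sigma> = tri i j k" ..
  have c: "case c \<sigma> of (i, j, k) \<Rightarrow> distinct [i, j, k] \<and> \<sigma> = tri i j k" if "\<sigma> \<in> t" for \<sigma>
    using c0 that by (rule bspec)
  define m where "m \<sigma> = (case c \<sigma> of (i, j, k) \<Rightarrow> lift w i j k)" for \<sigma>
  have cell: "measure lebesgue \<sigma> * (\<Sum>i | p i extreme_point_of \<sigma>. w$i) = 3 * integral \<sigma> (m \<sigma>)"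
    "integral \<sigma> f \<le> integral \<sigma> (m \<sigma>)"
    "integral \<sigma> (m \<sigma>) = integral \<sigma> f \<longleftrightarrow> (\<exists>a. affine_fun a \<and> (\<forall>x\<in>\<sigma>. f x = a x))" if "\<sigma> \<in> t" for \<sigma>
  proof -
    obtain i j k where "c \<sigma> = (i, j, k)" by (cases "c \<sigma>")
    then have d: "distinct [i, j, k]" and \<sigma>: "\<sigma> = tri i j k" and m: "m \<sigma> = lift w i j k"
      using c[OF that] by (auto simp: m_def)
    note iv = interp_vertices[OF orient_vertices[OF d]]
    show "measure lebesgue \<sigma> * (\<Sum>i | p i extreme_point_of \<sigma>. w$i) = 3 * integral \<sigma> (m \<sigma>)"
      unfolding m unfolding \<sigma> by (rule cell_integral[OF d])
    have aff: "affine_fun (m \<sigma>)" unfolding m by (rule affine_fun_interp)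
    have comp: "compact \<sigma>" unfolding \<sigma> by (intro finite_imp_compact_convex_hull) simp
    have int: "f integrable_on \<sigma>" "m \<sigma> integrable_on \<sigma>"
      by (intro integrable_on_compact comp cont affine_fun_continuous_on aff)+
    have le: "f x \<le> m \<sigma> x" if "x \<in> \<sigma>" for x
    proof -
      have "convex_on \<sigma> (\<lambda>x. f x + (- 1) * m \<sigma> x)"
        using convex_on_add[OF f affine_fun_convex_on[OF affine_fun_cmult[OF aff, of "-1"]]]
          convex_on_subset[of UNIV _ \<sigma>] convex_convex_hull[of "{p i, p j, p k}"] \<sigma> by auto
      moreover have "\<forall>x\<in>{p i, p j, p k}. f x + (- 1) * m \<sigma> x \<le> 0" using iv fw unfolding m by simp
      ultimately show ?thesis
        using convex_on_convex_hull_bound[of "{p i, p j, p k}" "\<lambda>x. f x + (- 1) * m \<sigma> x" 0] that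
        unfolding \<sigma>[symmetric] by auto
    qed
    show "integral \<sigma> f \<le> integral \<sigma> (m \<sigma>)" using le by (intro integral_le int)
    show "integral \<sigma> (m \<sigma>) = integral \<sigma> f \<longleftrightarrow> (\<exists>a. affine_fun a \<and> (\<forall>x\<in>\<sigma>. f x = a x))"
    proof
      assume eq: "integral \<sigma> (m \<sigma>) = integral \<sigma> f"
      have cl: "\<sigma> \<subseteq> closure (interior \<sigma>)"
        using convex_closure_interior[of \<sigma>] triangle_interior[OF orient_vertices[OF d]] closure_subset[of \<sigma>]
        unfolding \<sigma> by simp
      have "m \<sigma> x - f x = 0" if "x \<in> \<sigma>" for x
        using le eq int that
        by (intro integral_zero_imp_zero[OF comp cl continuous_on_diff[OF affine_fun_continuous_on[OF aff] cont]])
           (auto simp: integral_diff)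
      then show "\<exists>a. affine_fun a \<and> (\<forall>x\<in>\<sigma>. f x = a x)" using aff by (intro exI[of _ "m \<sigma>"]) auto
    next
      assume "\<exists>a. affine_fun a \<and> (\<forall>x\<in>\<sigma>. f x = a x)"
      then obtain a where a: "affine_fun a" "\<And>x. x \<in> \<sigma> \<Longrightarrow> f x = a x" by blast
      have "p i \<in> \<sigma>" "p j \<in> \<sigma>" "p k \<in> \<sigma>" unfolding \<sigma> by (auto intro: hull_inc)
      then have "a (p i) = w$i" "a (p j) = w$j" "a (p k) = w$k" using a(2) fw by metis+
      then have "a x = m \<sigma> x" for x
        using interp_unique[OF a(1) orient_vertices[OF d], of x] unfolding m by simp
      then show "integral \<sigma> (m \<sigma>) = integral \<sigma> f" using a(2) by (intro integral_cong) simp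
    qed
  qed
  have g: "gkz_vector p t \<bullet> w = 3 * (\<Sum>\<sigma>\<in>t. integral \<sigma> (m \<sigma>))"
    unfolding gkz_inner[OF finite_triangulation[OF t]] using cell(1) by (simp add: sum_distrib_left)
  have Qf: "integral Q f = (\<Sum>\<sigma>\<in>t. integral \<sigma> f)" by (rule integral_over_cells[OF t cont])
  show "3 * integral Q f \<le> gkz_vector p t \<bullet> w"
    unfolding g Qf using sum_mono[OF cell(2)] by simp
  have "(\<Sum>\<sigma>\<in>t. integral \<sigma> (m \<sigma>)) = (\<Sum>\<sigma>\<in>t. integral \<sigma> f) \<longleftrightarrow> (\<forall>\<sigma>\<in>t. integral \<sigma> (m \<sigma>) = integral \<sigma> f)"
  proof -
    have "(\<Sum>\<sigma>\<in>t. integral \<sigma> (m \<sigma>) - integral \<sigma> f) = 0 \<longleftrightarrow> (\<forall>\<sigma>\<in>t. integral \<sigma> (m \<sigma>) - integral \<sigma> f = 0)"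
      using cell(2) finite_triangulation[OF t] by (intro sum_nonneg_eq_0_iff) auto
    then show ?thesis by (simp add: sum_subtractf)
  qed
  then show "gkz_vector p t \<bullet> w = 3 * integral Q f \<longleftrightarrow> affine_on_cells f t"
    unfolding g Qf affine_on_cells_def using cell(3) by simp
qed

section \<open>Lower envelopes of height functions\<close>

text \<open>
  The envelope is the maximum of the affine interpolants of all lower triangles. On a lower
  triangle its own interpolant attains the maximum, and lower triangles cover \<open>Q\<close>.
\<close>

lemma lower_envelope:
  obtains f t where "convex_on UNIV f" "\<And>q. f (p q) = w$q" "polygon_triangulation Q t"
    "\<And>\<sigma>. \<sigma> \<in> t \<Longrightarrow> \<exists>a. affine_fun a \<and> (\<forall>x\<in>\<sigma>. f x = a x) \<and> (\<forall>x. a x \<le> f x)"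
proof -
  obtain t where t: "polygon_triangulation Q t" "t \<subseteq> lower_cells w"
    using lower_triangulation_exists by blast
  define K where "K = {(i, j, k). lower w i j k}"
  define f where "f x = Max ((\<lambda>(i, j, k). lift w i j k x) ` K)" for x
  have ge: "lift w i j k x \<le> f x" if "lower w i j k" for i j k x
    unfolding f_def using that by (intro Max_ge) (auto simp: K_def intro!: image_eqI[of _ _ "(i, j, k)"])
  have "K \<noteq> {}"
  proof -
    have "\<Union>(lower_cells w) \<noteq> {}" using lower_cells_cover vertex_in_Q by blast
    then show ?thesis unfolding lower_cells_def K_def by auto
  qed
  then have le: "f x \<le> c" if "\<And>i j k. lower w i j k \<Longrightarrow> lift w i j k x \<le> c" for x c
    unfolding f_def using that by (subst Max_le_iff) (auto simp: K_def)
  have conv: "convex_on UNIV f"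
  proof (rule convex_onI)
    fix s :: real and x y assume s: "0 < s" "s < 1"
    show "f ((1 - s) *\<^sub>R x + s *\<^sub>R y) \<le> (1 - s) * f x + s * f y"
    proof (rule le)
      fix i j k assume l: "lower w i j k"
      show "lift w i j k ((1 - s) *\<^sub>R x + s *\<^sub>R y) \<le> (1 - s) * f x + s * f y"
        unfolding affine_fun_segment[OF affine_fun_interp]
        using ge[OF l] s by (intro add_mono mult_left_mono) auto
    qed
  qed simp
  have cell: "f x = lift w i j k x" if l: "lower w i j k" and x: "x \<in> tri i j k" for i j k x
  proof (rule antisym[OF le ge[OF l]])
    fix i' j' k' assume "lower w i' j' k'"
    then show "lift w i' j' k' x \<le> lift w i j k x"
      using lower_le_on_lower_cell x l unfolding lower_def by blast
  qed
  show thesis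
  proof (rule that[OF conv _ t(1)])
    fix q
    obtain i j k where l: "lower w i j k" and q: "p q \<in> tri i j k"
      using lower_cells_cover[of w] vertex_in_Q[of q] unfolding lower_cells_def by blast
    then have "q \<in> {i, j, k}" using vertex_in_tri l unfolding lower_def by blast
    then show "f (p q) = w$q"
      using cell[OF l q] interp_vertices[OF orient_vertices[of i j k]] l unfolding lower_def by auto
  next
    fix \<sigma> assume "\<sigma> \<in> t"
    then obtain i j k where "lower w i j k" "\<sigma> = tri i j k" using t(2) unfolding lower_cells_def by blast
    then show "\<exists>a. affine_fun a \<and> (\<forall>x\<in>\<sigma>. f x = a x) \<and> (\<forall>x. a x \<le> f x)"
      using cell ge affine_fun_interp by (intro exI[of _ "lift w i j k"]) blast
  qed
qed

section \<open>Heights that are constant on the secondary polytope\<close>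

lemma Ass_I_hull: "Ass_I Q p = convex hull (gkz_vector p ` {t. polygon_triangulation Q t})"
  unfolding Ass_I_def secondary_polytope_def by (simp add: setcompr_eq_image)

lemma gkz_in_Ass_I: "polygon_triangulation Q t \<Longrightarrow> gkz_vector p t \<in> Ass_I Q p"
  unfolding Ass_I_hull by (simp add: hull_inc)

lemma polytope_Ass_I: "polytope (Ass_I Q p)"
  unfolding Ass_I_hull using finite_triangulations by (simp add: polytope_convex_hull)

lemma Ass_I_ge:
  assumes "convex_on UNIV f" "\<And>q. f (p q) = w$q" "x \<in> Ass_I Q p"
  shows "3 * integral Q f \<le> x \<bullet> w"
proof -
  have "Ass_I Q p \<subseteq> {x. w \<bullet> x \<ge> 3 * integral Q f}"
    unfolding Ass_I_hull
  proof (rule hull_minimal)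
    show "gkz_vector p ` {t. polygon_triangulation Q t} \<subseteq> {x. w \<bullet> x \<ge> 3 * integral Q f}"
      using gkz_convex_function(1)[OF _ assms(1,2)] by (auto simp: inner_commute)
  qed (rule convex_halfspace_ge)
  then show ?thesis using assms(3) by (auto simp: inner_commute)
qed

lemma affine_heights_constant:
  assumes a: "affine_fun a" and w: "\<And>q. w$q = a (p q)" and x: "x \<in> Ass_I Q p"
  shows "x \<bullet> w = 3 * integral Q a"
proof -
  have "Ass_I Q p \<subseteq> {x. w \<bullet> x = 3 * integral Q a}"
    unfolding Ass_I_hull
  proof (rule hull_minimal)
    have "gkz_vector p t \<bullet> w = 3 * integral Q a" if "polygon_triangulation Q t" for t
      using gkz_convex_function(2)[OF that affine_fun_convex_on[OF a], of w] w a
      unfolding affine_on_cells_def by auto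
    then show "gkz_vector p ` {t. polygon_triangulation Q t} \<subseteq> {x. w \<bullet> x = 3 * integral Q a}"
      by (auto simp: inner_commute)
  qed (rule convex_hyperplane)
  then show ?thesis using x by (auto simp: inner_commute)
qed

text \<open>
  If the functional is constant, its minimum and its maximum agree, so the lower envelope \<open>f\<close> of
  \<open>w\<close> and the upper envelope \<open>- g\<close>, where \<open>g\<close> is the lower envelope of \<open>- w\<close>, have the same
  integral and coincide on \<open>Q\<close>. Then \<open>f\<close> is both convex and concave, hence affine.
\<close>

lemma constant_heights_affine:
  assumes const: "\<And>x. x \<in> Ass_I Q p \<Longrightarrow> x \<bullet> w = c"
  shows "\<exists>a. affine_fun a \<and> (\<forall>q. w$q = a (p q))"
proof -
  obtain f t where f: "convex_on UNIV f" "\<And>q. f (p q) = w$q" and t: "polygon_triangulation Q t"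
    and ft: "\<And>\<sigma>. \<sigma> \<in> t \<Longrightarrow> \<exists>a. affine_fun a \<and> (\<forall>x\<in>\<sigma>. f x = a x) \<and> (\<forall>x. a x \<le> f x)"
    using lower_envelope[of w] by metis
  obtain g s where g: "convex_on UNIV g" "\<And>q. g (p q) = (- w)$q" and s: "polygon_triangulation Q s"
    and gs: "\<And>\<sigma>. \<sigma> \<in> s \<Longrightarrow> \<exists>a. affine_fun a \<and> (\<forall>x\<in>\<sigma>. g x = a x) \<and> (\<forall>x. a x \<le> g x)"
    using lower_envelope[of "- w"] by metis
  have cont: "continuous_on S f" "continuous_on S g" for S
    using convex_on_continuous[OF open_UNIV] f(1) g(1) continuous_on_subset by blast+
  have "affine_on_cells f t" "affine_on_cells g s" using ft gs unfolding affine_on_cells_def by blast+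
  then have "3 * integral Q f = c" "3 * integral Q g = - c"
    using gkz_convex_function(2)[OF t f] gkz_convex_function(2)[OF s g]
      const[OF gkz_in_Ass_I[OF t]] const[OF gkz_in_Ass_I[OF s]] by (simp_all add: inner_minus_right)
  moreover have "integral Q (\<lambda>x. - (f x + g x)) = - (integral Q f + integral Q g)"
    unfolding integral_neg using integral_add[of f Q g]
    by (simp add: integrable_on_compact compact_Q cont)
  ultimately have int0: "integral Q (\<lambda>x. - (f x + g x)) = 0" by simp
  have sum: "convex_on Q (\<lambda>x. f x + g x)"
    using convex_on_add[OF f(1) g(1)] convex_on_subset[of UNIV _ Q] convex_Q by blast
  have le: "f x + g x \<le> 0" if "x \<in> Q" for x
    using convex_on_convex_hull_bound[of "range p" "\<lambda>x. f x + g x" 0] sum that f(2) g(2)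
    unfolding Q_hull[symmetric] by simp
  have zero: "f x + g x = 0" if "x \<in> Q" for x
  proof -
    have "0 \<le> - (f y + g y)" if "y \<in> Q" for y using le[OF that] by linarith
    then have "- (f x + g x) = 0"
      using closure_interior_Q
      by (intro integral_zero_imp_zero[OF compact_Q _ continuous_on_minus[OF continuous_on_add[OF cont]] _ int0 that])
        simp_all
    then show ?thesis by simp
  qed
  obtain \<sigma> where \<sigma>: "\<sigma> \<in> t" using t vertex_in_Q unfolding polygon_triangulation_def by blast
  obtain a where a: "affine_fun a" "\<And>x. x \<in> \<sigma> \<Longrightarrow> f x = a x" "\<And>x. a x \<le> f x" using ft[OF \<sigma>] by blast
  obtain i j k where "distinct [i, j, k]" "\<sigma> = tri i j k" using triangulation_cell[OF t \<sigma>] by blast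
  then obtain z where z: "z \<in> interior \<sigma>" "\<sigma> \<subseteq> Q"
    using triangle_interior[OF orient_vertices] tri_subset_Q by blast
  then obtain e where e: "e > 0" "cball z e \<subseteq> Q"
    using mem_interior_cball[of z \<sigma>] by blast
  have "w$q = a (p q)" for q
  proof (rule ccontr)
    assume "w$q \<noteq> a (p q)"
    then have lt: "a (p q) < f (p q)" using a(3)[of "p q"] f(2)[of q] by simp
    \<comment> \<open>The segment from the vertex \<open>p q\<close> through \<open>z\<close> is extended by the factor \<open>\<delta>\<close> to a point
      \<open>y\<close> that still belongs to \<open>Q\<close>. The convex function \<open>g + a\<close> is nonpositive on \<open>Q\<close>,
      negative at \<open>p q\<close> and zero at the point \<open>z\<close> in between, which is impossible.\<close>
    define \<delta> where "\<delta> = e / (norm (p q - z) + 1)"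
    have \<delta>: "\<delta> > 0" unfolding \<delta>_def using e(1) by (simp add: add_nonneg_pos)
    define y where "y = z - \<delta> *\<^sub>R (p q - z)"
    have "\<delta> * norm (p q - z) \<le> \<delta> * (norm (p q - z) + 1)" using \<delta> by simp
    also have "\<dots> = e" unfolding \<delta>_def by (simp add: add_nonneg_eq_0_iff)
    finally have "\<delta> * norm (p q - z) \<le> e" .
    then have y: "y \<in> Q" using e(2) \<delta> unfolding y_def by (auto simp: dist_norm)
    define r where "r = 1 / (1 + \<delta>)"
    have r: "0 < r" "r < 1" "(1 + \<delta>) * r = 1" using \<delta> by (simp_all add: r_def)
    have "(1 + \<delta>) *\<^sub>R ((1 - r) *\<^sub>R p q + r *\<^sub>R y) = (1 + \<delta> - (1 + \<delta>) * r) *\<^sub>R p q + ((1 + \<delta>) * r) *\<^sub>R y"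
      by (simp add: algebra_simps)
    also have "\<dots> = (1 + \<delta>) *\<^sub>R z" unfolding r(3) y_def by (simp add: algebra_simps)
    finally have zeq: "(1 - r) *\<^sub>R p q + r *\<^sub>R y = z" using \<delta> by simp
    have "g ((1 - r) *\<^sub>R p q + r *\<^sub>R y) \<le> (1 - r) * g (p q) + r * g y"
      using convex_onD[OF g(1), of r "p q" y] r by simp
    then have "g z \<le> (1 - r) * g (p q) + r * g y" unfolding zeq .
    moreover have "g z = - a z" using zero[of z] a(2)[of z] z interior_subset[of \<sigma>] by force
    moreover have "a z = (1 - r) * a (p q) + r * a y" using affine_fun_segment[OF a(1), of r "p q" y] zeq by simp
    moreover have "g (p q) = - f (p q)" "g y = - f y" using zero[OF vertex_in_Q] zero[OF y] by (simp_all add: eq_neg_iff_add_eq_0 add.commute)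
    moreover have "(1 - r) * a (p q) < (1 - r) * f (p q)" using lt r by simp
    moreover have "r * a y \<le> r * f y" using a(3) r by simp
    ultimately show False by simp
  qed
  then show ?thesis using a(1) by blast
qed

section \<open>Facets of the secondary polytope\<close>

definition fold_fun :: "'v \<Rightarrow> 'v \<Rightarrow> real^2 \<Rightarrow> real" where
  "fold_fun i j x = max 0 (orient (p i) (p j) x)"

definition fold_height :: "'v \<Rightarrow> 'v \<Rightarrow> real^'v" where
  "fold_height i j = (\<chi> q. fold_fun i j (p q))"

lemma convex_fold_fun: "convex_on UNIV (fold_fun i j)"
proof (rule convex_onI)
  fix t :: real and x y assume t: "0 < t" "t < 1"
  have "(1 - t) * orient (p i) (p j) x \<le> (1 - t) * fold_fun i j x" "t * orient (p i) (p j) y \<le> t * fold_fun i j y"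
    "0 \<le> (1 - t) * fold_fun i j x" "0 \<le> t * fold_fun i j y"
    using t by (simp_all add: fold_fun_def)
  then show "fold_fun i j ((1 - t) *\<^sub>R x + t *\<^sub>R y) \<le> (1 - t) * fold_fun i j x + t * fold_fun i j y"
    using affine_fun_segment[OF affine_fun_orient, of "p i" "p j" t x y]
    by (subst fold_fun_def) simp
qed simp

definition diagonal :: "'v \<Rightarrow> 'v \<Rightarrow> bool" where
  "diagonal i j \<longleftrightarrow> (\<exists>q. orient (p i) (p j) (p q) < 0) \<and> (\<exists>q. 0 < orient (p i) (p j) (p q))"

lemma diagonal_distinct: "diagonal i j \<Longrightarrow> i \<noteq> j"
  unfolding diagonal_def by auto

text \<open>
  The heights vanish at three vertices that are not collinear but are positive somewhere.
\<close>

lemma fold_height_not_affine: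
  assumes ij: "diagonal i j"
    and a: "affine_fun a" "\<And>q. fold_height i j $ q = a (p q)"
  shows False
proof -
  obtain q r where q: "orient (p i) (p j) (p q) < 0" and r: "0 < orient (p i) (p j) (p r)"
    using ij unfolding diagonal_def by blast
  have "a (p i) = 0" "a (p j) = 0" "a (p q) = 0"
    using a(2)[of i] a(2)[of j] a(2)[of q] q by (simp_all add: fold_height_def fold_fun_def)
  then have "a (p r) = 0" using affine_fun_eq_0[OF a(1), of "p i" "p j" "p q" "p r"] q by simp
  then show False using a(2)[of r] r by (simp add: fold_height_def fold_fun_def)
qed

text \<open>
  Both open half-planes meet the closure of the interior, hence the interior itself, where the
  intermediate value on a segment is zero.
\<close>

lemma cell_crossed_in_interior:
  assumes a: "affine_fun a" and C: "convex C" "C \<subseteq> closure (interior C)"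
    and xy: "x \<in> C" "y \<in> C" "a x < 0" "0 < a y"
  shows "\<exists>z\<in>interior C. a z = 0"
proof -
  have near: "\<exists>x'\<in>interior C. x' \<in> U" if "open U" "x \<in> U" "x \<in> C" for U x
    using that C(2) open_Int_closure_eq_empty[of U "interior C"] by blast
  have "open {x. a x < 0}" "open {x. 0 < a x}"
    using affine_fun_continuous_on[OF a, of UNIV] by (auto intro!: open_Collect_less continuous_on_const)
  then obtain x' y' where x': "x' \<in> interior C" "a x' < 0" and y': "y' \<in> interior C" "0 < a y'"
    using near[of "{x. a x < 0}" x] near[of "{x. 0 < a x}" y] xy by blast
  define s where "s = a x' / (a x' - a y')"
  have s: "0 \<le> s" "s \<le> 1" using x'(2) y'(2) by (simp_all add: s_def divide_le_eq zero_le_divide_iff)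
  define z where "z = (1 - s) *\<^sub>R x' + s *\<^sub>R y'"
  have "z \<in> interior C"
    unfolding z_def using convex_interior[OF C(1)] x'(1) y'(1) s by (intro convexD) auto
  moreover have "a z = a x' - s * (a x' - a y')"
    unfolding z_def affine_fun_segment[OF a] by (simp add: algebra_simps)
  then have "a z = 0" using x'(2) y'(2) by (simp add: s_def)
  ultimately show ?thesis by blast
qed

text \<open>
  The points where \<open>f\<close> meets a supporting affine function \<open>a\<close> form a polygon whose vertices are
  vertices of \<open>Q\<close>: on each triangle of \<open>t\<close> the nonnegative function \<open>f - a\<close> is affine, and its
  zero set is spanned by the vertices at which it vanishes.
\<close>

lemma contact_set_hull:
  assumes f: "convex_on UNIV f" "\<And>q. f (p q) = w$q"
    and t: "polygon_triangulation Q t" "affine_on_cells f t"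
    and a: "affine_fun a" "\<And>x. x \<in> Q \<Longrightarrow> a x \<le> f x"
  shows "{x \<in> Q. f x = a x} = convex hull (p ` {q. w$q = a (p q)})"
proof
  show "{x \<in> Q. f x = a x} \<subseteq> convex hull (p ` {q. w$q = a (p q)})"
  proof
    fix x assume "x \<in> {x \<in> Q. f x = a x}"
    then have x: "x \<in> Q" "f x = a x" by auto
    then obtain \<tau> where \<tau>: "\<tau> \<in> t" "x \<in> \<tau>" using t(1) unfolding polygon_triangulation_def by blast
    obtain b where b: "affine_fun b" "\<And>y. y \<in> \<tau> \<Longrightarrow> f y = b y"
      using t(2) \<tau>(1) unfolding affine_on_cells_def by blast
    obtain i j k where ijk: "\<tau> = tri i j k" using triangulation_cell[OF t(1) \<tau>(1)] by blast
    have mem: "s \<in> \<tau>" if "s \<in> {p i, p j, p k}" for s using that unfolding ijk by (rule hull_inc)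
    have "x \<in> convex hull {s \<in> {p i, p j, p k}. b s - a s = 0}"
    proof (rule affine_fun_zero_hull)
      show "affine_fun (\<lambda>x. b x - a x)" by (intro affine_fun_diff a b)
      show "0 \<le> b s - a s" if "s \<in> {p i, p j, p k}" for s
        using b(2)[OF mem[OF that]] a(2)[of s] vertex_in_Q that by auto
      show "b x - a x = 0" using b(2)[OF \<tau>(2)] x(2) by simp
    qed (use \<tau> ijk in auto)
    moreover have "{s \<in> {p i, p j, p k}. b s - a s = 0} \<subseteq> p ` {q. w$q = a (p q)}"
    proof
      fix s assume s: "s \<in> {s \<in> {p i, p j, p k}. b s - a s = 0}"
      then obtain q where q: "s = p q" by blast
      have "w$q = a (p q)" using s b(2)[OF mem] f(2)[of q] q by auto
      then show "s \<in> p ` {q. w$q = a (p q)}" using q by blast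
    qed
    ultimately show "x \<in> convex hull (p ` {q. w$q = a (p q)})" using hull_mono by blast
  qed
  show "convex hull (p ` {q. w$q = a (p q)}) \<subseteq> {x \<in> Q. f x = a x}"
  proof
    fix x assume x: "x \<in> convex hull (p ` {q. w$q = a (p q)})"
    have xQ: "x \<in> Q" using x hull_mono[of "p ` {q. w$q = a (p q)}" "range p" convex] unfolding Q_hull by blast
    have "convex_on UNIV (\<lambda>x. f x + (- 1) * a x)"
      by (intro convex_on_add f affine_fun_convex_on affine_fun_cmult a)
    then have "convex_on (convex hull (p ` {q. w$q = a (p q)})) (\<lambda>x. f x + (- 1) * a x)"
      using convex_on_subset convex_convex_hull by blast
    then have "f x + (- 1) * a x \<le> 0"
      by (rule convex_on_convex_hull_bound[rule_format]) (use f(2) x in auto)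
    then show "x \<in> {x \<in> Q. f x = a x}" using a(2)[OF xQ] xQ by simp
  qed
qed

text \<open>
  The maximal region \<open>R\<close> on which \<open>f\<close> equals one affine function \<open>a\<close> is a polygon different
  from \<open>Q\<close>, so it has an edge \<open>E\<close> through the interior of \<open>Q\<close>. Its endpoints are vertices
  of \<open>Q\<close>, and by \<open>line_Int_Q\<close> its line meets \<open>Q\<close> in nothing but \<open>E\<close>. A triangle on which
  \<open>f\<close> is affine and whose interior meets \<open>E\<close> would touch \<open>a\<close> in an interior point, hence lie
  in \<open>R\<close>, and put a boundary point of \<open>R\<close> into its interior. So the line through \<open>E\<close> crosses
  no such triangle.
\<close>

lemma extreme_fold_line:
  assumes f: "convex_on UNIV f" "\<And>q. f (p q) = w$q"
    and t: "polygon_triangulation Q t"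
    and ft: "\<And>\<sigma>. \<sigma> \<in> t \<Longrightarrow> \<exists>a. affine_fun a \<and> (\<forall>x\<in>\<sigma>. f x = a x) \<and> (\<forall>x. a x \<le> f x)"
    and not_affine: "\<not> (\<exists>a. affine_fun a \<and> (\<forall>q. w$q = a (p q)))"
  shows "\<exists>i j. diagonal i j \<and>
    (\<forall>t'. polygon_triangulation Q t' \<and> affine_on_cells f t' \<longrightarrow> affine_on_cells (fold_fun i j) t')"
proof -
  have fat: "affine_on_cells f t" using ft unfolding affine_on_cells_def by blast
  obtain \<sigma> where \<sigma>: "\<sigma> \<in> t" using t vertex_in_Q unfolding polygon_triangulation_def by blast
  obtain a where a: "affine_fun a" "\<And>x. x \<in> \<sigma> \<Longrightarrow> f x = a x" "\<And>x. a x \<le> f x" using ft[OF \<sigma>] by blast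
  obtain k1 k2 k3 where k: "distinct [k1, k2, k3]" "\<sigma> = tri k1 k2 k3"
    using triangulation_cell[OF t \<sigma>] by blast
  define W where "W = {q. w$q = a (p q)}"
  define R where "R = {x \<in> Q. f x = a x}"
  have R_hull: "R = convex hull (p ` W)"
    unfolding R_def W_def by (rule contact_set_hull[OF f t fat a(1)]) (rule a(3))
  have poly: "polytope R" unfolding R_hull by (intro polytope_convex_hull) simp
  have "\<sigma> \<subseteq> R" using a(2) k(2) tri_subset_Q unfolding R_def by blast
  then have "interior \<sigma> \<subseteq> interior R" by (rule interior_mono)
  moreover have "interior \<sigma> \<noteq> {}" using triangle_interior[OF orient_vertices[OF k(1)]] k(2) by simp
  ultimately have intR: "interior R \<noteq> {}" by blast
  have cR: "closed R" "convex R" using poly polytope_imp_closed polytope_imp_convex by auto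
  have RQ: "R \<subseteq> Q" unfolding R_def by blast
  have "\<not> interior Q \<subseteq> R"
  proof
    assume "interior Q \<subseteq> R"
    then have "Q \<subseteq> R" using closure_minimal[OF _ cR(1)] closure_interior_Q by metis
    then have "\<forall>q. w$q = a (p q)" using vertex_in_Q f(2) unfolding R_def by force
    then show False using not_affine a(1) by blast
  qed
  moreover have "interior Q \<inter> R \<noteq> {}" using intR interior_mono[OF RQ] interior_subset by blast
  ultimately have "interior Q \<inter> frontier R \<noteq> {}"
    using connected_Int_frontier[of "interior Q" R] convex_connected[OF convex_interior[OF convex_Q]] by blast
  then obtain x where x: "x \<in> interior Q" "x \<in> rel_frontier R"
    using rel_frontier_nonempty_interior[OF intR] by blast
  then obtain E where E: "E facet_of R" "x \<in> E"
    unfolding rel_frontier_of_polyhedron[OF polytope_imp_polyhedron[OF poly]] by blast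
  have Eface: "E face_of R" and Edim: "aff_dim E = 1"
    using E(1) aff_dim_nonempty_interior[OF intR] unfolding facet_of_def by auto
  have "polytope E" using face_of_polytope_polytope[OF poly Eface] .
  then obtain u v where uv: "E = closed_segment u v"
    using compact_convex_collinear_segment[of E] E(2) Edim polytope_imp_compact polytope_imp_convex
    by (metis collinear_aff_dim empty_iff order_refl)
  have "u \<noteq> v" using Edim uv by auto
  have vert: "\<exists>i. y = p i" if "y \<in> {u, v}" for y
  proof -
    have "y extreme_point_of E" using that unfolding uv by (auto simp: extreme_point_of_segment)
    then have "y extreme_point_of R" using extreme_point_of_face[OF Eface] by blast
    then show ?thesis unfolding R_hull using extreme_point_of_convex_hull by blast
  qed
  obtain i j where ij: "u = p i" "v = p j" using vert[of u] vert[of v] by auto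
  have ne: "i \<noteq> j" using ij \<open>u \<noteq> v\<close> by blast
  define l where "l = orient (p i) (p j)"
  have l: "affine_fun l" unfolding l_def by (rule affine_fun_orient)
  have lE: "l y = 0" if y: "y \<in> E" for y
  proof -
    obtain s where "y = (1 - s) *\<^sub>R p i + s *\<^sub>R p j" using y unfolding uv ij by (auto simp: in_segment)
    then show ?thesis unfolding l_def using affine_fun_segment[OF affine_fun_orient] by simp
  qed
  have "\<exists>k. l (p k) \<noteq> 0"
  proof -
    obtain k where "k \<noteq> i" "k \<noteq> j" using k(1) by (metis distinct_length_2_or_more)
    then show ?thesis using orient_vertices[of i j k] ne unfolding l_def by auto
  qed
  \<comment> \<open>The edge passes through an interior point of \<open>Q\<close>, so \<open>Q\<close> cannot lie on one side of its
    line; \<open>both\<close> states this for the two sides by the sign of \<open>c\<close>.\<close>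
  then have both: "\<not> (\<forall>q. 0 \<le> c * l (p q))" if "c \<noteq> 0" for c
  proof -
    assume h: "\<exists>k. l (p k) \<noteq> 0"
    have aff: "affine_fun (\<lambda>x. c * l x)" using affine_fun_cmult[OF l] .
    show ?thesis
    proof
      assume "\<forall>q. 0 \<le> c * l (p q)"
      then have nonneg: "0 \<le> c * l y" if "y \<in> Q" for y
        using affine_fun_nonneg_hull[OF aff, of "range p" y] that unfolding Q_hull by auto
      have "c * l x = 0" using lE[OF E(2)] by simp
      then have "c * l y = 0" for y using affine_fun_zero_interior[OF aff nonneg x(1)] by simp
      then show False using h that by auto
    qed
  qed
  then have diag: "diagonal i j"
    using both[of 1] both[of "-1"] unfolding diagonal_def l_def[symmetric] by (auto simp: not_le)
  have "affine_on_cells (fold_fun i j) t'" if t': "polygon_triangulation Q t'" "affine_on_cells f t'" for t'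
    unfolding affine_on_cells_def
  proof
    fix \<tau> assume \<tau>: "\<tau> \<in> t'"
    obtain b where b: "affine_fun b" "\<And>y. y \<in> \<tau> \<Longrightarrow> f y = b y"
      using t'(2) \<tau> unfolding affine_on_cells_def by blast
    obtain j1 j2 j3 where j: "distinct [j1, j2, j3]" "\<tau> = tri j1 j2 j3"
      using triangulation_cell[OF t'(1) \<tau>] by blast
    have \<tau>Q: "\<tau> \<subseteq> Q" using j(2) tri_subset_Q by blast
    have conv: "convex \<tau>" unfolding j(2) by (rule convex_convex_hull)
    have clo: "\<tau> \<subseteq> closure (interior \<tau>)"
      using convex_closure_interior[OF conv] triangle_interior[OF orient_vertices[OF j(1)]] closure_subset[of \<tau>]
      unfolding j(2) by simp
    have "\<not> (\<exists>y\<in>\<tau>. \<exists>z\<in>\<tau>. l y < 0 \<and> 0 < l z)"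
    proof
      assume "\<exists>y\<in>\<tau>. \<exists>z\<in>\<tau>. l y < 0 \<and> 0 < l z"
      then obtain z where z: "z \<in> interior \<tau>" "l z = 0"
        using cell_crossed_in_interior[OF l conv clo] by blast
      have zQ: "z \<in> Q" using z(1) \<tau>Q interior_subset by blast
      have zE: "z \<in> E" unfolding uv ij using line_Int_Q[OF ne zQ] z(2) unfolding l_def by blast
      then have "f z = a z" using face_of_imp_subset[OF Eface] unfolding R_def by blast
      moreover have "f z = b z" using b(2) z(1) interior_subset by blast
      ultimately have "b z - a z = 0" by simp
      then have "b y - a y = 0" for y
        using affine_fun_zero_interior[OF affine_fun_diff[OF b(1) a(1)] _ z(1)] b(2) a(3)
        by (metis diff_ge_0_iff_ge)
      then have "\<tau> \<subseteq> R" using b(2) \<tau>Q unfolding R_def by auto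
      then have "z \<in> interior R" using z(1) interior_mono by blast
      moreover have "E \<noteq> R" using Edim aff_dim_nonempty_interior[OF intR] by auto
      ultimately show False using face_of_disjoint_interior[OF Eface] zE by blast
    qed
    then consider "\<forall>y\<in>\<tau>. 0 \<le> l y" | "\<forall>y\<in>\<tau>. l y \<le> 0" by (meson not_less)
    then show "\<exists>a. affine_fun a \<and> (\<forall>y\<in>\<tau>. fold_fun i j y = a y)"
    proof cases
      case 1
      then show ?thesis using l by (intro exI[of _ l]) (simp add: fold_fun_def l_def)
    next
      case 2
      then show ?thesis
        using affine_fun_const[of 0] by (intro exI[of _ "\<lambda>x. 0"]) (simp add: fold_fun_def l_def)
    qed
  qed
  then show ?thesis using diag by blast
qed

text \<open>
  Let \<open>w\<close> expose the facet \<open>F\<close>, so that \<open>F\<close> is spanned by the triangulations adapted to the lower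
  envelope of \<open>w\<close>. By \<open>extreme_fold_line\<close> they are also adapted to a folded function, which
  therefore attains its minimum on all of \<open>F\<close>. It is not constant on the polytope, and a
  proper face that contains a facet equals it.
\<close>

lemma facet_is_fold_face:
  assumes F: "F facet_of Ass_I Q p"
  shows "\<exists>i j. diagonal i j \<and>
    F = {x \<in> Ass_I Q p. x \<bullet> fold_height i j = 3 * integral Q (fold_fun i j)}"
proof -
  define P where "P = Ass_I Q p"
  have poly: "polytope P" unfolding P_def by (rule polytope_Ass_I)
  have face: "F face_of P" and ne: "F \<noteq> {}" and dim: "aff_dim F = aff_dim P - 1"
    using F unfolding facet_of_def P_def by auto
  have "F exposed_face_of P"
    using face exposed_face_of_polyhedron[OF polytope_imp_polyhedron[OF poly]] by blast
  then obtain v b where v: "P \<subseteq> {x. v \<bullet> x \<le> b}" "F = P \<inter> {x. v \<bullet> x = b}"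
    unfolding exposed_face_of_def by blast
  define w where "w = - v"
  obtain f t where f: "convex_on UNIV f" "\<And>q. f (p q) = w$q" and t: "polygon_triangulation Q t"
    and ft: "\<And>\<sigma>. \<sigma> \<in> t \<Longrightarrow> \<exists>a. affine_fun a \<and> (\<forall>x\<in>\<sigma>. f x = a x) \<and> (\<forall>x. a x \<le> f x)"
    using lower_envelope[of w] by metis
  have "affine_on_cells f t" using ft unfolding affine_on_cells_def by blast
  then have gt: "gkz_vector p t \<bullet> w = 3 * integral Q f" using gkz_convex_function(2)[OF t f] by simp
  have b: "b = - (3 * integral Q f)"
  proof (rule antisym)
    obtain y where y: "y \<in> P" "v \<bullet> y = b" using ne v(2) by blast
    then have "3 * integral Q f \<le> y \<bullet> w" using Ass_I_ge[OF f] unfolding P_def by blast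
    then show "b \<le> - (3 * integral Q f)" using y(2) by (simp add: w_def inner_commute)
    have "v \<bullet> gkz_vector p t \<le> b" using v(1) gkz_in_Ass_I[OF t] unfolding P_def by blast
    then show "- (3 * integral Q f) \<le> b" using gt by (simp add: w_def inner_commute)
  qed
  have F_eq: "F = {x \<in> P. x \<bullet> w = 3 * integral Q f}"
    unfolding v(2) b by (auto simp: w_def inner_commute)
  have not_affine: "\<not> (\<exists>a. affine_fun a \<and> (\<forall>q. w$q = a (p q)))"
  proof
    assume "\<exists>a. affine_fun a \<and> (\<forall>q. w$q = a (p q))"
    then obtain a where a: "affine_fun a" "\<And>q. w$q = a (p q)" by blast
    then have "x \<bullet> w = 3 * integral Q a" if "x \<in> P" for x
      using affine_heights_constant[OF a] that unfolding P_def by blast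
    then have "F = P" using ne unfolding F_eq by auto
    then show False using dim by simp
  qed
  obtain i j where ij: "diagonal i j"
    and fold: "\<And>t'. polygon_triangulation Q t' \<Longrightarrow> affine_on_cells f t' \<Longrightarrow> affine_on_cells (fold_fun i j) t'"
    using extreme_fold_line[OF f t ft not_affine] by blast
  define G where "G = {x \<in> P. x \<bullet> fold_height i j = 3 * integral Q (fold_fun i j)}"
  have fh: "fold_fun i j (p q) = fold_height i j $ q" for q by (simp add: fold_height_def)
  have G_eq: "G = P \<inter> {x. fold_height i j \<bullet> x = 3 * integral Q (fold_fun i j)}"
    unfolding G_def by (auto simp: inner_commute)
  have G_face: "G face_of P"
    unfolding G_eq
  proof (rule face_of_Int_supporting_hyperplane_ge)
    show "convex P" using poly polytope_imp_convex by blast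
    show "fold_height i j \<bullet> x \<ge> 3 * integral Q (fold_fun i j)" if "x \<in> P" for x
      using Ass_I_ge[OF convex_fold_fun fh] that unfolding P_def by (simp add: inner_commute)
  qed
  have "F \<subseteq> G"
  proof -
    obtain S where S: "S \<subseteq> gkz_vector p ` {t. polygon_triangulation Q t}" "F = convex hull S"
      using face finite_triangulations unfolding P_def Ass_I_hull
      by (meson face_of_convex_hull_subset finite_imageI finite_imp_compact)
    have "S \<subseteq> {x. fold_height i j \<bullet> x = 3 * integral Q (fold_fun i j)}"
    proof
      fix x assume x: "x \<in> S"
      then obtain t' where t': "polygon_triangulation Q t'" "x = gkz_vector p t'" using S(1) by blast
      have "x \<in> F" using x S(2) hull_inc by metis
      then have "affine_on_cells f t'" using gkz_convex_function(2)[OF t'(1) f] t'(2) unfolding F_eq by simp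
      then have "affine_on_cells (fold_fun i j) t'" using fold t'(1) by blast
      then show "x \<in> {x. fold_height i j \<bullet> x = 3 * integral Q (fold_fun i j)}"
        using gkz_convex_function(2)[OF t'(1) convex_fold_fun fh] t'(2) by (simp add: inner_commute)
    qed
    then have "F \<subseteq> {x. fold_height i j \<bullet> x = 3 * integral Q (fold_fun i j)}"
      unfolding S(2) by (intro hull_minimal convex_hyperplane)
    then show ?thesis using face_of_imp_subset[OF face] unfolding G_eq by blast
  qed
  moreover have "G \<noteq> P"
  proof
    assume "G = P"
    then have "x \<bullet> fold_height i j = 3 * integral Q (fold_fun i j)" if "x \<in> Ass_I Q p" for x
      using that unfolding G_def P_def by blast
    then show False using constant_heights_affine fold_height_not_affine[OF ij] by metis
  qed
  ultimately have "F = G"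
  proof -
    assume FG: "F \<subseteq> G" and GP: "G \<noteq> P"
    have "aff_dim G < aff_dim P"
      using face_of_aff_dim_lt[OF polytope_imp_convex[OF poly] G_face GP] .
    moreover have "F face_of G" using face_of_subset[OF face FG face_of_imp_subset[OF G_face]] .
    then have "F \<noteq> G \<Longrightarrow> aff_dim F < aff_dim G"
      using face_of_aff_dim_lt[OF face_of_imp_convex[OF G_face]] by blast
    ultimately show "F = G" using dim by linarith
  qed
  then show ?thesis using ij unfolding G_def P_def by blast
qed

section \<open>Independence of distinct diagonals\<close>

lemma fold_fun_swap: "fold_fun j i x = fold_fun i j x - orient (p i) (p j) x"
  using orient_swap[of "p j" "p i" x] by (auto simp: fold_fun_def max_def)

lemma diagonal_swap: "diagonal i j \<Longrightarrow> diagonal j i"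
  using orient_swap[of "p j" "p i"] unfolding diagonal_def by auto

text \<open>
  Folding towards the other side of the same line changes the function by an affine one only. So
  the orientation of each diagonal may be chosen freely when affine combinations are
  studied.
\<close>

lemma fold_combination_swap:
  assumes "\<exists>A. affine_fun A \<and> (\<forall>q. c * fold_fun i j (p q) + B q = A (p q))"
  shows "\<exists>A. affine_fun A \<and> (\<forall>q. c * fold_fun j i (p q) + B q = A (p q))"
proof -
  obtain A where A: "affine_fun A" "\<And>q. c * fold_fun i j (p q) + B q = A (p q)" using assms by blast
  show ?thesis
  proof (intro exI conjI allI)
    show "affine_fun (\<lambda>x. A x - c * orient (p i) (p j) x)"
      by (intro affine_fun_diff affine_fun_cmult affine_fun_orient A)
    show "c * fold_fun j i (p q) + B q = A (p q) - c * orient (p i) (p j) (p q)" for q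
      using A(2)[of q] unfolding fold_fun_swap[of j i] by (simp add: right_diff_distrib)
  qed
qed

lemma orient_diagonal_eq_0: "i \<noteq> j \<Longrightarrow> orient (p i) (p j) (p q) = 0 \<longleftrightarrow> q = i \<or> q = j"
  using orient_vertices[of i j q] by auto

text \<open>
  Suppose \<open>q\<close> were on the positive side of both lines. The segment from \<open>q\<close> to \<open>k\<close> crosses the line
  through \<open>i\<close> and \<open>j\<close> inside \<open>Q\<close>, hence on the diagonal \<open>i j\<close>, where the other function is
  nonpositive. But on this segment it is positive except at \<open>k\<close> itself, so \<open>k\<close> lies on the
  line through \<open>i\<close> and \<open>j\<close>. The same holds for \<open>l\<close>, and the diagonals coincide.
\<close>

lemma noncrossing_regions_disjoint:
  assumes ij: "i \<noteq> j" and kl: "k \<noteq> l" and ne: "{i, j} \<noteq> {k, l}"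
    and le: "orient (p i) (p j) (p k) \<le> 0" "orient (p i) (p j) (p l) \<le> 0"
      "orient (p k) (p l) (p i) \<le> 0" "orient (p k) (p l) (p j) \<le> 0"
    and q: "0 < orient (p i) (p j) (p q)"
  shows "orient (p k) (p l) (p q) \<le> 0"
proof (rule ccontr)
  assume "\<not> orient (p k) (p l) (p q) \<le> 0"
  then have q': "0 < orient (p k) (p l) (p q)" by simp
  have *: "orient (p i) (p j) (p m) = 0" if m: "m \<in> {k, l}" for m
  proof (rule ccontr)
    assume "orient (p i) (p j) (p m) \<noteq> 0"
    then have neg: "orient (p i) (p j) (p m) < 0" using m le by auto
    define s where "s = orient (p i) (p j) (p q) / (orient (p i) (p j) (p q) - orient (p i) (p j) (p m))"
    have s: "0 \<le> s" "s < 1" using q neg by (simp_all add: s_def divide_less_eq)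
    define x where "x = (1 - s) *\<^sub>R p q + s *\<^sub>R p m"
    have "x \<in> Q" unfolding x_def using convex_Q vertex_in_Q s by (intro convexD) auto
    moreover have "orient (p i) (p j) x = orient (p i) (p j) (p q) - s * (orient (p i) (p j) (p q) - orient (p i) (p j) (p m))"
      unfolding x_def affine_fun_segment[OF affine_fun_orient] by (simp add: algebra_simps)
    then have "orient (p i) (p j) x = 0" using q neg by (simp add: s_def)
    ultimately have "x \<in> convex hull {p i, p j}"
      using line_Int_Q[OF ij] by (simp add: segment_convex_hull)
    moreover have "affine_fun (\<lambda>x. (- 1) * orient (p k) (p l) x)"
      by (rule affine_fun_cmult[OF affine_fun_orient])
    ultimately have "0 \<le> (- 1) * orient (p k) (p l) x"
      using le(3,4) affine_fun_nonneg_hull[of "\<lambda>x. (- 1) * orient (p k) (p l) x" "{p i, p j}" x] by auto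
    moreover have "orient (p k) (p l) x = (1 - s) * orient (p k) (p l) (p q)"
      unfolding x_def affine_fun_segment[OF affine_fun_orient] using m by auto
    moreover have "0 < (1 - s) * orient (p k) (p l) (p q)" using s q' by simp
    ultimately show False by simp
  qed
  then show False using ne kl orient_diagonal_eq_0[OF ij] by auto
qed

text \<open>
  If \<open>k\<close> and \<open>l\<close> lie on different sides of the first diagonal, then the segment between them meets
  this diagonal in a point that is a vertex of neither. That point is a proper convex combination
  of \<open>i\<close> and \<open>j\<close> on the second line, so \<open>i\<close> and \<open>j\<close> lie on different sides of it.
\<close>

lemma crossing_symmetric:
  assumes ij: "i \<noteq> j" and kl: "k \<noteq> l"
    and cross: "orient (p i) (p j) (p k) < 0" "0 < orient (p i) (p j) (p l)"
  shows "orient (p k) (p l) (p i) * orient (p k) (p l) (p j) < 0"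
proof -
  define a b where "a = orient (p i) (p j) (p k)" and "b = orient (p i) (p j) (p l)"
  define s where "s = a / (a - b)"
  have s: "0 < s" "s < 1" using cross by (simp_all add: s_def a_def b_def divide_less_eq zero_less_divide_iff)
  define x where "x = (1 - s) *\<^sub>R p k + s *\<^sub>R p l"
  have xQ: "x \<in> Q" unfolding x_def using convex_Q vertex_in_Q s by (intro convexD) auto
  have "orient (p i) (p j) x = a - s * (a - b)"
    unfolding x_def affine_fun_segment[OF affine_fun_orient] a_def b_def by (simp add: algebra_simps)
  then have "orient (p i) (p j) x = 0" using cross by (simp add: s_def a_def b_def)
  then obtain r where r: "0 \<le> r" "r \<le> 1" "x = (1 - r) *\<^sub>R p i + r *\<^sub>R p j"
    using line_Int_Q[OF ij xQ] by (auto simp: in_segment)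
  have kl0: "i \<noteq> k" "i \<noteq> l" "j \<noteq> k" "j \<noteq> l" using cross by auto
  have n0: "orient (p k) (p l) (p i) \<noteq> 0" "orient (p k) (p l) (p j) \<noteq> 0"
    using orient_diagonal_eq_0[OF kl] kl0 by auto
  have "orient (p k) (p l) x = 0" unfolding x_def affine_fun_segment[OF affine_fun_orient] by simp
  then have sum: "(1 - r) * orient (p k) (p l) (p i) + r * orient (p k) (p l) (p j) = 0"
    unfolding r(3) affine_fun_segment[OF affine_fun_orient] .
  then have "r \<noteq> 0" "r \<noteq> 1" using n0 by auto
  then have r': "0 < r" "0 < 1 - r" using r by auto
  show ?thesis
  proof (rule ccontr)
    assume "\<not> ?thesis"
    then have "0 < orient (p k) (p l) (p i) * orient (p k) (p l) (p j)" using n0 by (simp add: not_less order_less_le)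
    then consider "0 < orient (p k) (p l) (p i)" "0 < orient (p k) (p l) (p j)"
      | "orient (p k) (p l) (p i) < 0" "orient (p k) (p l) (p j) < 0" by (auto simp: zero_less_mult_iff)
    then show False
    proof cases
      case 1
      then show False using sum mult_pos_pos[OF r'(2) 1(1)] mult_pos_pos[OF r'(1) 1(2)] by linarith
    next
      case 2
      then show False using sum mult_pos_neg[OF r'(2) 2(1)] mult_pos_neg[OF r'(1) 2(2)] by linarith
    qed
  qed
qed

text \<open>
  With both diagonals oriented so that the other one lies on the nonpositive side, the affine
  function \<open>A\<close> vanishes at all endpoints, among which three are not collinear, hence identically.
  A vertex beyond one diagonal lies on the zero side of the other and isolates one
  coefficient.
\<close>

lemma noncrossing_folds_independent:
  assumes ij: "diagonal i j" and kl: "diagonal k l" and ne: "{i, j} \<noteq> {k, l}"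
    and le: "orient (p i) (p j) (p k) \<le> 0" "orient (p i) (p j) (p l) \<le> 0"
      "orient (p k) (p l) (p i) \<le> 0" "orient (p k) (p l) (p j) \<le> 0"
    and A: "affine_fun A" "\<And>q. c * fold_fun i j (p q) + d * fold_fun k l (p q) = A (p q)"
  shows "c = 0 \<and> d = 0"
proof -
  have dist: "i \<noteq> j" "k \<noteq> l" using ij kl diagonal_distinct by auto
  have "A (p i) = 0" "A (p j) = 0" "A (p k) = 0" "A (p l) = 0"
    using A(2)[of i] A(2)[of j] A(2)[of k] A(2)[of l] le by (simp_all add: fold_fun_def)
  moreover have "(k \<noteq> i \<and> k \<noteq> j) \<or> (l \<noteq> i \<and> l \<noteq> j)" using ne dist by auto
  then have "orient (p i) (p j) (p k) \<noteq> 0 \<or> orient (p i) (p j) (p l) \<noteq> 0"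
    using orient_diagonal_eq_0[OF dist(1)] by blast
  ultimately have A0: "A x = 0" for x using affine_fun_eq_0[OF A(1)] by blast
  obtain q where q: "0 < orient (p i) (p j) (p q)" using ij unfolding diagonal_def by blast
  have "orient (p k) (p l) (p q) \<le> 0" by (rule noncrossing_regions_disjoint[OF dist ne le q])
  then have "c = 0" using A(2)[of q] A0 q by (simp add: fold_fun_def)
  obtain r where r: "0 < orient (p k) (p l) (p r)" using kl unfolding diagonal_def by blast
  have "orient (p i) (p j) (p r) \<le> 0"
    by (rule noncrossing_regions_disjoint[OF dist(2,1) ne[symmetric] le(3,4,1,2) r])
  then have "d = 0" using A(2)[of r] A0 r by (simp add: fold_fun_def)
  then show ?thesis using \<open>c = 0\<close> by simp
qed

text \<open>
  A further vertex \<open>q\<close>, in the quadrant where both folded functions vanish, gives together with the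
  two endpoints \<open>x\<close> and \<open>y\<close> adjacent to this quadrant three zeros of \<open>A\<close>. The opposite endpoints
  then isolate the coefficients. For a quadrilateral there is no such vertex, and indeed its
  two diagonals give folded functions with an affine combination.
\<close>

lemma crossing_folds_independent:
  assumes A: "affine_fun A" "\<And>q. c * fold_fun i j (p q) + d * fold_fun k l (p q) = A (p q)"
    and q: "orient (p i) (p j) (p q) < 0" "orient (p k) (p l) (p q) < 0"
    and x: "orient (p i) (p j) (p x) < 0" "0 < orient (p i) (p j) (p x')" "{x, x'} = {k, l}"
    and y: "orient (p k) (p l) (p y) < 0" "0 < orient (p k) (p l) (p y')" "{y, y'} = {i, j}"
  shows "c = 0 \<and> d = 0"
proof -
  have on: "orient (p i) (p j) (p y) = 0" "orient (p i) (p j) (p y') = 0"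
    "orient (p k) (p l) (p x) = 0" "orient (p k) (p l) (p x') = 0"
    using x(3) y(3) by (auto simp: doubleton_eq_iff)
  have "A (p q) = 0" "A (p x) = 0" "A (p y) = 0"
    using A(2)[of q] A(2)[of x] A(2)[of y] q x(1) y(1) on by (simp_all add: fold_fun_def)
  moreover have "distinct [q, x, y]" using q on x(1) by auto
  ultimately have A0: "A z = 0" for z using affine_fun_eq_0[OF A(1) orient_vertices] by blast
  have "c = 0" using A(2)[of x'] A0 x(2) on by (simp add: fold_fun_def)
  moreover have "d = 0" using A(2)[of y'] A0 y(2) on by (simp add: fold_fun_def)
  ultimately show ?thesis by simp
qed

text \<open>
  Five vertices provide one outside two crossing diagonals. After reorienting the diagonals, one of
  the two preceding cases applies.
\<close>

lemma folds_independent: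
  assumes card: "5 \<le> CARD('v)"
    and ij: "diagonal i j" and kl: "diagonal k l" and ne: "{i, j} \<noteq> {k, l}"
    and A: "\<exists>A. affine_fun A \<and> (\<forall>q. c * fold_fun i j (p q) + d * fold_fun k l (p q) = A (p q))"
  shows "c = 0 \<and> d = 0"
proof -
  let ?A = "\<lambda>i j k l. \<exists>A. affine_fun A \<and> (\<forall>q. c * fold_fun i j (p q) + d * fold_fun k l (p q) = A (p q))"
  have swap1: "?A i j k l \<Longrightarrow> ?A j i k l" for i j k l by (rule fold_combination_swap)
  have swap2: "?A i j k l \<Longrightarrow> ?A i j l k" for i j k l
    using fold_combination_swap[of d k l "\<lambda>q. c * fold_fun i j (p q)"] by (simp add: add.commute)
  have dist: "i \<noteq> j" "k \<noteq> l" using ij kl diagonal_distinct by auto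
  note flip = orient_swap[of "p j" "p i"] orient_swap[of "p l" "p k"]
  show ?thesis
  proof (cases "orient (p i) (p j) (p k) * orient (p i) (p j) (p l) < 0")
    case True
    have "card {i, j, k, l} \<le> 4" by (simp add: card_insert_if)
    then have "{i, j, k, l} \<noteq> (UNIV :: 'v set)" using card by force
    then obtain q where q: "q \<notin> {i, j, k, l}" by blast
    have nz: "orient (p i) (p j) (p q) \<noteq> 0" "orient (p k) (p l) (p q) \<noteq> 0"
      using q orient_diagonal_eq_0 dist by auto
    \<comment> \<open>The case in which the further vertex lies on the negative side of both diagonals; the other
      cases reduce to it by exchanging endpoints.\<close>
    have main: "c = 0 \<and> d = 0" if A': "?A i j k l" and dist: "i \<noteq> j" "k \<noteq> l"
      and neg: "orient (p i) (p j) (p k) * orient (p i) (p j) (p l) < 0"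
      and q: "orient (p i) (p j) (p q) < 0" "orient (p k) (p l) (p q) < 0" for i j k l
    proof -
      have sym: "orient (p k) (p l) (p i) * orient (p k) (p l) (p j) < 0"
      proof (cases "orient (p i) (p j) (p k) < 0")
        case True
        then show ?thesis using crossing_symmetric[OF dist] neg by (simp add: mult_less_0_iff)
      next
        case False
        then have "orient (p l) (p k) (p i) * orient (p l) (p k) (p j) < 0"
          using neg dist by (intro crossing_symmetric) (auto simp: mult_less_0_iff)
        then show ?thesis by (simp add: orient_swap[of "p l" "p k"])
      qed
      obtain x x' where x: "orient (p i) (p j) (p x) < 0" "0 < orient (p i) (p j) (p x')" "{x, x'} = {k, l}"
        using neg by (metis insert_commute mult_less_0_iff)
      obtain y y' where y: "orient (p k) (p l) (p y) < 0" "0 < orient (p k) (p l) (p y')" "{y, y'} = {i, j}"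
        using sym by (metis insert_commute mult_less_0_iff)
      show ?thesis using A' crossing_folds_independent[OF _ _ q x y] by blast
    qed
    have neg: "orient (p j) (p i) (p k) * orient (p j) (p i) (p l) < 0"
      "orient (p i) (p j) (p l) * orient (p i) (p j) (p k) < 0"
      "orient (p j) (p i) (p l) * orient (p j) (p i) (p k) < 0"
      using True by (simp_all add: flip mult.commute)
    consider "orient (p i) (p j) (p q) < 0" "orient (p k) (p l) (p q) < 0"
      | "orient (p j) (p i) (p q) < 0" "orient (p k) (p l) (p q) < 0"
      | "orient (p i) (p j) (p q) < 0" "orient (p l) (p k) (p q) < 0"
      | "orient (p j) (p i) (p q) < 0" "orient (p l) (p k) (p q) < 0"
      using nz unfolding flip neg_less_0_iff_less by (meson linorder_neqE)
    then show ?thesis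
    proof cases
      case 1 then show ?thesis using main[OF A dist True] by blast
    next
      case 2 then show ?thesis using main[OF swap1[OF A] dist(1)[symmetric] dist(2) neg(1)] by blast
    next
      case 3 then show ?thesis using main[OF swap2[OF A] dist(1) dist(2)[symmetric] neg(2)] by blast
    next
      case 4 then show ?thesis
        using main[OF swap2[OF swap1[OF A]] dist(1)[symmetric] dist(2)[symmetric] neg(3)] by blast
    qed
  next
    case False
    have sym: "\<not> orient (p k) (p l) (p i) * orient (p k) (p l) (p j) < 0"
    proof
      assume neg: "orient (p k) (p l) (p i) * orient (p k) (p l) (p j) < 0"
      show False
      proof (cases "orient (p k) (p l) (p i) < 0")
        case True
        then show ?thesis using crossing_symmetric[OF dist(2,1)] neg False by (simp add: mult_less_0_iff)
      next
        case F: False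
        then have "orient (p j) (p i) (p k) * orient (p j) (p i) (p l) < 0"
          using neg dist by (intro crossing_symmetric) (auto simp: mult_less_0_iff)
        then show ?thesis using False by (simp add: flip)
      qed
    qed
    have side: "(orient (p i) (p j) (p k) \<le> 0 \<and> orient (p i) (p j) (p l) \<le> 0)
        \<or> (orient (p j) (p i) (p k) \<le> 0 \<and> orient (p j) (p i) (p l) \<le> 0)"
      using False unfolding flip by (smt (verit) mult_less_0_iff)
    have side': "(orient (p k) (p l) (p i) \<le> 0 \<and> orient (p k) (p l) (p j) \<le> 0)
        \<or> (orient (p l) (p k) (p i) \<le> 0 \<and> orient (p l) (p k) (p j) \<le> 0)"
      using sym unfolding flip by (smt (verit) mult_less_0_iff)
    have main: "c = 0 \<and> d = 0" if "?A i j k l" "diagonal i j" "diagonal k l" "{i, j} \<noteq> {k, l}"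
      "orient (p i) (p j) (p k) \<le> 0" "orient (p i) (p j) (p l) \<le> 0"
      "orient (p k) (p l) (p i) \<le> 0" "orient (p k) (p l) (p j) \<le> 0" for i j k l
      using noncrossing_folds_independent[OF that(2-8)] that(1) by blast
    have ne': "{j, i} \<noteq> {k, l}" "{i, j} \<noteq> {l, k}" "{j, i} \<noteq> {l, k}"
      using ne by (simp_all add: insert_commute)
    show ?thesis
      using side side' main[OF A ij kl ne] main[OF swap1[OF A] diagonal_swap[OF ij] kl ne'(1)]
        main[OF swap2[OF A] ij diagonal_swap[OF kl] ne'(2)]
        main[OF swap2[OF swap1[OF A]] diagonal_swap[OF ij] diagonal_swap[OF kl] ne'(3)]
      by argo
  qed
qed

section \<open>Facets with the same direction space\<close>

text \<open>
  The functions folded to the two sides of a line differ by an affine function, and the functional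
  of an affine function is constant on the polytope.
\<close>

lemma same_line_same_facet:
  "{x \<in> Ass_I Q p. x \<bullet> fold_height i j = 3 * integral Q (fold_fun i j)}
    = {x \<in> Ass_I Q p. x \<bullet> fold_height j i = 3 * integral Q (fold_fun j i)}"
proof -
  define L :: "real^'v" where "L = (\<chi> q. orient (p i) (p j) (p q))"
  have "x \<bullet> L = 3 * integral Q (orient (p i) (p j))" if "x \<in> Ass_I Q p" for x
    by (rule affine_heights_constant[OF affine_fun_orient _ that]) (simp add: L_def)
  moreover have "fold_height j i = fold_height i j - L"
    by (simp add: fold_height_def L_def vec_eq_iff fold_fun_swap[of j i])
  moreover have "integral Q (fold_fun j i) = integral Q (fold_fun i j) - integral Q (orient (p i) (p j))"
  proof -
    have "continuous_on Q (fold_fun i j)"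
      using convex_on_continuous[OF open_UNIV convex_fold_fun] continuous_on_subset by blast
    then have "fold_fun i j integrable_on Q" "orient (p i) (p j) integrable_on Q"
      using integrable_on_compact[OF compact_Q] affine_fun_continuous_on[OF affine_fun_orient] by blast+
    then have "integral Q (\<lambda>x. fold_fun i j x - orient (p i) (p j) x) = integral Q (fold_fun i j) - integral Q (orient (p i) (p j))"
      by (rule integral_diff)
    then show ?thesis by (simp add: fold_fun_swap[of j i, abs_def])
  qed
  ultimately show ?thesis by (auto simp: inner_diff_right)
qed

text \<open>
  Both folded functionals are constant on \<open>F\<close>: the first because it exposes \<open>F\<close>, the second because
  it is orthogonal to the direction space of \<open>F'\<close>. A combination that also takes the same value
  at one further point \<open>y0\<close> of the polytope is constant on the affine span of \<open>F\<close> and \<open>y0\<close>, and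
  this span contains the polytope because \<open>F\<close> has codimension one in it.
\<close>

lemma parallel_facets_eq:
  assumes card: "5 \<le> CARD('v)"
    and F: "F facet_of Ass_I Q p" and F': "F' facet_of Ass_I Q p"
    and par: "parallel_facets F F'"
  shows "F = F'"
proof (rule ccontr)
  assume neq: "F \<noteq> F'"
  define P where "P = Ass_I Q p"
  obtain i j where ij: "diagonal i j"
    and F_eq: "F = {x \<in> P. x \<bullet> fold_height i j = 3 * integral Q (fold_fun i j)}"
    using facet_is_fold_face[OF F] unfolding P_def by blast
  obtain k l where kl: "diagonal k l"
    and F'_eq: "F' = {x \<in> P. x \<bullet> fold_height k l = 3 * integral Q (fold_fun k l)}"
    using facet_is_fold_face[OF F'] unfolding P_def by blast
  have ne: "{i, j} \<noteq> {k, l}"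
    using neq F_eq F'_eq same_line_same_facet[of i j] unfolding P_def by (auto simp: doubleton_eq_iff)
  define u u' where "u = fold_height i j" and "u' = fold_height k l"
  have face: "F face_of P" and Fne: "F \<noteq> {}" and dim: "aff_dim F = aff_dim P - 1"
    using F unfolding facet_of_def P_def by auto
  have FP: "F \<subseteq> P" using face by (rule face_of_imp_subset)
  obtain x0 where x0: "x0 \<in> F" using Fne by blast
  have "F \<noteq> P" using dim by auto
  then obtain y0 where y0: "y0 \<in> P" "y0 \<notin> F" using FP by blast
  have u_const: "u \<bullet> x = u \<bullet> x0" if "x \<in> F" for x
    using that x0 unfolding F_eq u_def by (simp add: inner_commute)
  have u'_const: "u' \<bullet> x = u' \<bullet> x0" if "x \<in> F" for x
  proof -
    have "u' \<bullet> x = 3 * integral Q (fold_fun k l)" if "x \<in> F'" for x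
      using that unfolding F'_eq u'_def by (simp add: inner_commute)
    then have "{x - y | x y. x extreme_point_of F' \<and> y extreme_point_of F'} \<subseteq> {z. u' \<bullet> z = 0}"
      unfolding extreme_point_of_def by (auto simp: inner_diff_right)
    then have "direction_space F' \<subseteq> {z. u' \<bullet> z = 0}"
      unfolding direction_space_def by (intro span_minimal subspace_hyperplane)
    then have D: "direction_space F \<subseteq> {z. u' \<bullet> z = 0}"
      using par unfolding parallel_facets_def by simp
    have orth: "u' \<bullet> (x - y) = 0" if "x extreme_point_of F" "y extreme_point_of F" for x y
    proof -
      have "x - y \<in> direction_space F"
        unfolding direction_space_def by (rule span_base) (use that in blast)
      then show ?thesis using D by blast
    qed
    have "polytope F" using face_of_polytope_polytope[OF _ face] polytope_Ass_I unfolding P_def by blast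
    then have hull: "F = convex hull {x. x extreme_point_of F}"
      by (intro Krein_Milman_Minkowski polytope_imp_compact polytope_imp_convex)
    then obtain e where e: "e extreme_point_of F" using Fne by fastforce
    have "{x. x extreme_point_of F} \<subseteq> {z. u' \<bullet> z = u' \<bullet> e}"
      using orth[OF _ e] by (auto simp: inner_diff_right)
    then have "convex hull {x. x extreme_point_of F} \<subseteq> {z. u' \<bullet> z = u' \<bullet> e}"
      by (intro hull_minimal convex_hyperplane)
    then have "F \<subseteq> {z. u' \<bullet> z = u' \<bullet> e}" using hull by blast
    then have "u' \<bullet> x = u' \<bullet> e" "u' \<bullet> x0 = u' \<bullet> e" using that x0 by auto
    then show ?thesis by simp
  qed
  \<comment> \<open>These coefficients make the combination vanish in the direction from \<open>x0\<close> to \<open>y0\<close>.\<close>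
  define c d where "c = u' \<bullet> (y0 - x0)" and "d = - (u \<bullet> (y0 - x0))"
  have "u \<bullet> y0 \<noteq> u \<bullet> x0"
    using y0 x0 unfolding F_eq u_def by (auto simp: inner_commute)
  then have d: "d \<noteq> 0" by (simp add: d_def inner_diff_right)
  define v where "v = c *\<^sub>R u + d *\<^sub>R u'"
  have y0_hull: "y0 \<notin> affine hull F"
  proof
    assume "y0 \<in> affine hull F"
    moreover have "affine hull F \<subseteq> {z. u \<bullet> z = u \<bullet> x0}"
      using u_const by (intro hull_minimal affine_hyperplane) auto
    ultimately show False using \<open>u \<bullet> y0 \<noteq> u \<bullet> x0\<close> by blast
  qed
  have "aff_dim (insert y0 F) = aff_dim P" using aff_dim_insert[of y0 F] y0_hull dim by simp
  then have "affine hull (insert y0 F) = affine hull P"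
    using aff_dim_eq_full_gen[of "insert y0 F" P] FP y0(1) by simp
  moreover have "affine hull (insert y0 F) \<subseteq> {z. v \<bullet> z = v \<bullet> x0}"
  proof (intro hull_minimal affine_hyperplane)
    have "v \<bullet> (y0 - x0) = 0" unfolding v_def inner_add_left inner_scaleR_left c_def d_def by simp
    then have "v \<bullet> y0 = v \<bullet> x0" by (simp add: inner_diff_right)
    moreover have "v \<bullet> x = v \<bullet> x0" if "x \<in> F" for x
      using u_const[OF that] u'_const[OF that] by (simp add: v_def inner_add_left)
    ultimately show "insert y0 F \<subseteq> {z. v \<bullet> z = v \<bullet> x0}" by blast
  qed
  ultimately have "x \<bullet> v = v \<bullet> x0" if "x \<in> Ass_I Q p" for x
    using hull_subset[of P affine] that unfolding P_def by (auto simp: inner_commute)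
  then obtain A where "affine_fun A" "\<And>q. v$q = A (p q)" using constant_heights_affine by metis
  then have "\<exists>A. affine_fun A \<and> (\<forall>q. c * fold_fun i j (p q) + d * fold_fun k l (p q) = A (p q))"
    by (intro exI[of _ A]) (simp add: v_def u_def u'_def fold_height_def)
  then show False using folds_independent[OF card ij kl ne] d by blast
qed

end

theorem theorem2p6:
  fixes n :: nat
    and Q :: "(real ^ 2) set"
    and p :: "'v::finite \<Rightarrow> real ^ 2"
  assumes "n \<ge> 2"
    and "CARD('v) = n + 3"
    and "labelled_convex_polygon Q p"
  shows "\<not> (\<exists>F F'. F facet_of Ass_I Q p \<and> F' facet_of Ass_I Q p \<and> F \<noteq> F' \<and> parallel_facets F F')"
proof -
  interpret convex_polygon Q p by unfold_locales (rule assms(3))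
  show ?thesis using parallel_facets_eq assms(1,2) by auto
qed

end
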